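(* Let $n\ge2$ and let $q_1,q_2\in\mathbb{C}$ with $q_1q_2\neq0$ be such that $q=-q_2/q_1$ is not a root of unity. Then the Zariski closure in $\mathrm{GL}(\mathbf{F})$ of the image of the reduced Burau representation $\rho:B_n\to\mathrm{GL}(\mathbf{F})$ contains $\mathrm{SL}(\mathbf{F})$. Hence, for every $k\ge1$, $\operatorname{End}_{B_n}(\mathbf{F}^{\otimes k})=\operatorname{End}_{\mathrm{GL}(\mathbf{F})}(\mathbf{F}^{\otimes k})$, where both groups act diagonally on $\mathbf{F}^{\otimes k}$.
   Context: Artin's braid group $B_n$ is generated by $\sigma_1,\dots,\sigma_{n-1}$ subject to $\sigma_i\sigma_{i+1}\sigma_i=\sigma_{i+1}\sigma_i\sigma_{i+1}$ and $\sigma_i\sigma_j=\sigma_j\sigma_i$ for $|i-j|>1$. Let $\mathbf{E}=\mathbb{C}^n$ with basis $e_1,\dots,e_n$ and generalized Burau action $\sigma_i e_j=q_1e_j$ ($j\ne i,i+1$), $\sigma_i e_{i+1}=-q_2e_i$, $\sigma_i e_i=(q_1+q_2)e_i+q_1e_{i+1}$. Let $f_i=q_2e_i+q_1e_{i+1}$ for $1\le i\le n-1$ and $\mathbf{F}=\mathrm{span}(f_1,\dots,f_{n-1})$, an $(n-1)$-dimensional $B_n$-submodule of $\mathbf{E}$; the reduced Burau representation $\rho$ is the action of $B_n$ on $\mathbf{F}$. *)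

theory Defs
  imports "Jordan_Normal_Form.Determinant"
begin

(* Indices are 0-based: the basis e_1..e_n of E is e_0..e_{n-1} here, the generator
   sigma_{i+1} of B_n is indexed by i < n - 1, and f_{j+1} = q2 e_j + q1 e_{j+1}. *)

text \<open>Matrix of the generalized Burau action of sigma_{i+1} on E = C^n
  (column c = image of e_c in the basis e).\<close>
definition burau_E :: "complex \<Rightarrow> complex \<Rightarrow> nat \<Rightarrow> nat \<Rightarrow> complex mat" where
  "burau_E q1 q2 n i = mat n n (\<lambda>(r, c).
     if c = i then (if r = i then q1 + q2 else if r = i + 1 then q1 else 0)
     else if c = i + 1 then (if r = i then - q2 else 0)
     else (if r = c then q1 else 0))"

definition F_basis :: "complex \<Rightarrow> complex \<Rightarrow> nat \<Rightarrow> complex mat" where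
  "F_basis q1 q2 n = mat n (n - 1) (\<lambda>(r, j).
     if r = j then q2 else if r = j + 1 then q1 else 0)"

text \<open>Matrix of the reduced Burau action rho(sigma_{i+1}) on F in the basis f:
  the matrix M with (action on E) * (basis of F) = (basis of F) * M.\<close>
definition rho_gen :: "complex \<Rightarrow> complex \<Rightarrow> nat \<Rightarrow> nat \<Rightarrow> complex mat" where
  "rho_gen q1 q2 n i = (THE M. M \<in> carrier_mat (n - 1) (n - 1) \<and>
       burau_E q1 q2 n i * F_basis q1 q2 n = F_basis q1 q2 n * M)"

inductive_set burau_image :: "complex \<Rightarrow> complex \<Rightarrow> nat \<Rightarrow> complex mat set"
  for q1 q2 n where
  one: "1\<^sub>m (n - 1) \<in> burau_image q1 q2 n"
| gen: "M \<in> burau_image q1 q2 n \<Longrightarrow> i < n - 1 \<Longrightarrow>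
        M * rho_gen q1 q2 n i \<in> burau_image q1 q2 n"
| inv: "M \<in> burau_image q1 q2 n \<Longrightarrow> i < n - 1 \<Longrightarrow>
        G \<in> carrier_mat (n - 1) (n - 1) \<Longrightarrow> G * rho_gen q1 q2 n i = 1\<^sub>m (n - 1) \<Longrightarrow>
        M * G \<in> burau_image q1 q2 n"

inductive_set poly_fun :: "nat \<Rightarrow> (complex mat \<Rightarrow> complex) set" for m where
  const: "(\<lambda>A. c) \<in> poly_fun m"
| entry: "i < m \<Longrightarrow> j < m \<Longrightarrow> (\<lambda>A. A $$ (i, j)) \<in> poly_fun m"
| add: "p \<in> poly_fun m \<Longrightarrow> p' \<in> poly_fun m \<Longrightarrow> (\<lambda>A. p A + p' A) \<in> poly_fun m"
| mult: "p \<in> poly_fun m \<Longrightarrow> p' \<in> poly_fun m \<Longrightarrow> (\<lambda>A. p A * p' A) \<in> poly_fun m"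

definition GL_mat :: "nat \<Rightarrow> complex mat set" where
  "GL_mat m = {A \<in> carrier_mat m m. det A \<noteq> 0}"

definition SL_mat :: "nat \<Rightarrow> complex mat set" where
  "SL_mat m = {A \<in> carrier_mat m m. det A = 1}"

text \<open>Zariski closure of S inside GL_m(C). (Regular functions on GL_m are p/det^k with
  p polynomial; since det is a unit there, they have the same zero sets.)\<close>
definition zariski_closure_GL :: "nat \<Rightarrow> complex mat set \<Rightarrow> complex mat set" where
  "zariski_closure_GL m S = {A \<in> GL_mat m. \<forall>p \<in> poly_fun m. (\<forall>B \<in> S. p B = 0) \<longrightarrow> p A = 0}"

text \<open>Tensor power: F^{(x)k} with basis f_{I_0} (x) ... (x) f_{I_{k-1}}, a multi-index
  (I_0,...,I_{k-1}) in {0..<m}^k being encoded as the number sum_j I_j m^j < m^k.\<close>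
definition digit :: "nat \<Rightarrow> nat \<Rightarrow> nat \<Rightarrow> nat" where
  "digit m I j = (I div m ^ j) mod m"

definition tensor_pow :: "nat \<Rightarrow> nat \<Rightarrow> complex mat \<Rightarrow> complex mat" where
  "tensor_pow m k A = mat (m ^ k) (m ^ k)
     (\<lambda>(I, J). \<Prod>j<k. A $$ (digit m I j, digit m J j))"

definition End_tensor :: "nat \<Rightarrow> nat \<Rightarrow> complex mat set \<Rightarrow> complex mat set" where
  "End_tensor m k G = {T \<in> carrier_mat (m ^ k) (m ^ k).
      \<forall>g \<in> G. T * tensor_pow m k g = tensor_pow m k g * T}"

end

(* Up to the scalar q1, rho(sigma_i) is a pseudo-reflection I + f_i phi_i whose special eigenvalue
   -q is not a root of unity, so the Zariski closure Z of C^* rho(B_n) in the full matrix algebra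
   contains I + t f_i phi_i for all t. Let V_i be the space of linear forms phi such that
   I + t f_i phi lies in Z for all t. Conjugating I + w f_j psi by I + f_i phi / r and letting
   r -> 0 shows that neighbouring V_i coincide. As q is not a root of unity the phi_i are linearly
   independent, so every V_i is the whole dual space. Scalars drop out of commutators, hence
   commutators of invertible elements of Z lie in the closure of rho(B_n); these include all
   transvections, which generate SL(F). For the tensor powers, commuting with g on F^{(x)k} is a
   polynomial condition on g, and GL(F) is generated by SL(F) and scalars. *)
theory Submission
  imports Defs "HOL-Computational_Algebra.Fundamental_Theorem_Algebra"
begin

subsection \<open>Zariski closure in the matrix algebra\<close>

text \<open>The closure is taken among all matrices, singular ones included, because the curves
  below pass through singular points: I + t f_i phi degenerates when t phi(f_i) = -1. Every limit
  then becomes the statement that a polynomial in one variable with infinitely many zeros vanishes,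
  and no topology enters. Nonzero scalars are adjoined because q1 is arbitrary apart from being
  nonzero: dividing the generator by q1 leaves I + f_i phi_i, whose k-th power is I + (1 + (-q) +
  ... + (-q)^(k-1)) f_i phi_i, with pairwise distinct coefficients. The hypothesis on q acts in two
  ways: through powers of -q (if (-q)^d = 1 then q^(2d) = 1), and through 1 + q + ... + q^m \<noteq>
  0 with m = n - 1, which makes the phi_i independent. Inversion is not polynomial but rational,
  adjugate over determinant; hence closures have to be carried through rational maps with a common
  denominator.\<close>

lemma poly_fun_sum:
  assumes "\<And>x. x \<in> S \<Longrightarrow> f x \<in> poly_fun m"
  shows "(\<lambda>A. \<Sum>x\<in>S. f x A) \<in> poly_fun m"
  using assms
proof (induction S rule: infinite_finite_induct)
  case (insert x F)
  then show ?case using poly_fun.add[of "f x" m "\<lambda>A. \<Sum>x\<in>F. f x A"] by simp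
qed (simp_all add: poly_fun.const)

lemma poly_fun_prod:
  assumes "\<And>x. x \<in> S \<Longrightarrow> f x \<in> poly_fun m"
  shows "(\<lambda>A. \<Prod>x\<in>S. f x A) \<in> poly_fun m"
  using assms
proof (induction S rule: infinite_finite_induct)
  case (insert x F)
  then show ?case using poly_fun.mult[of "f x" m "\<lambda>A. \<Prod>x\<in>F. f x A"] by simp
qed (simp_all add: poly_fun.const)

lemma poly_fun_scale: "p \<in> poly_fun m \<Longrightarrow> (\<lambda>A. c * p A) \<in> poly_fun m"
  using poly_fun.mult[OF poly_fun.const] .

lemma poly_fun_power: "p \<in> poly_fun m \<Longrightarrow> (\<lambda>A. p A ^ k) \<in> poly_fun m"
proof (induction k)
  case (Suc k)
  then show ?case using poly_fun.mult[of p m "\<lambda>A. p A ^ k"] by simp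
qed (simp add: poly_fun.const)

lemma index_mult_mat_sum:
  assumes "A \<in> carrier_mat m k" "B \<in> carrier_mat k l" "i < m" "j < l"
  shows "(A * B) $$ (i, j) = (\<Sum>x<k. A $$ (i, x) * B $$ (x, j))"
  using assms by (auto simp: scalar_prod_def lessThan_atLeast0)

definition zariski_closure_mat :: "nat \<Rightarrow> complex mat set \<Rightarrow> complex mat set" where
  "zariski_closure_mat m S =
     {A \<in> carrier_mat m m. \<forall>p \<in> poly_fun m. (\<forall>B \<in> S. p B = 0) \<longrightarrow> p A = 0}"

lemma zariski_closure_mat_carrier: "A \<in> zariski_closure_mat m S \<Longrightarrow> A \<in> carrier_mat m m"
  by (simp add: zariski_closure_mat_def)

lemma subset_zariski_closure_mat:
  "S \<subseteq> carrier_mat m m \<Longrightarrow> S \<subseteq> zariski_closure_mat m S"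
  by (auto simp: zariski_closure_mat_def)

lemma zariski_closure_mat_idem:
  "zariski_closure_mat m (zariski_closure_mat m S) = zariski_closure_mat m S"
  by (auto simp: zariski_closure_mat_def)

text \<open>Clearing denominators: if the entries of M are the fractions e_ij(A) / d(A), then p(M)
  becomes polynomial in A after multiplication by a power of d(A). The exponent N depends on p only.
  Written without division, the relation makes sense also where d vanishes.\<close>

lemma poly_fun_quotient:
  assumes "p \<in> poly_fun m" and d: "d \<in> poly_fun m"
    and e: "\<And>i j. i < m \<Longrightarrow> j < m \<Longrightarrow> e i j \<in> poly_fun m"
  shows "\<exists>N. \<exists>p'\<in>poly_fun m. \<forall>A M. (\<forall>i<m. \<forall>j<m. d A * M $$ (i, j) = e i j A) \<longrightarrow>
           p' A = d A ^ N * p M"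
  using assms(1)
proof induction
  case (const c)
  show ?case by (rule exI[of _ 0], rule bexI[of _ "\<lambda>A. c"]) (auto intro: poly_fun.const)
next
  case (entry i j)
  then show ?case by (intro exI[of _ 1], intro bexI[of _ "e i j"]) (auto intro: e)
next
  case (add p1 p2)
  then obtain N1 N2 p1' p2' where *: "p1' \<in> poly_fun m" "p2' \<in> poly_fun m"
    "\<forall>A M. (\<forall>i<m. \<forall>j<m. d A * M $$ (i, j) = e i j A) \<longrightarrow> p1' A = d A ^ N1 * p1 M"
    "\<forall>A M. (\<forall>i<m. \<forall>j<m. d A * M $$ (i, j) = e i j A) \<longrightarrow> p2' A = d A ^ N2 * p2 M"
    by blast
  show ?case
  proof (intro exI[of _ "N1 + N2"] bexI[of _ "\<lambda>A. d A ^ N2 * p1' A + d A ^ N1 * p2' A"] allI impI)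
    fix A M assume "\<forall>i<m. \<forall>j<m. d A * M $$ (i, j) = e i j A"
    with *(3,4) have "p1' A = d A ^ N1 * p1 M" "p2' A = d A ^ N2 * p2 M" by blast+
    then show "d A ^ N2 * p1' A + d A ^ N1 * p2' A = d A ^ (N1 + N2) * (p1 M + p2 M)"
      by (simp add: power_add algebra_simps)
  qed (intro poly_fun.add poly_fun.mult poly_fun_power d *(1,2))
next
  case (mult p1 p2)
  then obtain N1 N2 p1' p2' where *: "p1' \<in> poly_fun m" "p2' \<in> poly_fun m"
    "\<forall>A M. (\<forall>i<m. \<forall>j<m. d A * M $$ (i, j) = e i j A) \<longrightarrow> p1' A = d A ^ N1 * p1 M"
    "\<forall>A M. (\<forall>i<m. \<forall>j<m. d A * M $$ (i, j) = e i j A) \<longrightarrow> p2' A = d A ^ N2 * p2 M"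
    by blast
  show ?case
  proof (intro exI[of _ "N1 + N2"] bexI[of _ "\<lambda>A. p1' A * p2' A"] allI impI)
    fix A M assume "\<forall>i<m. \<forall>j<m. d A * M $$ (i, j) = e i j A"
    with *(3,4) have "p1' A = d A ^ N1 * p1 M" "p2' A = d A ^ N2 * p2 M" by blast+
    then show "p1' A * p2' A = d A ^ (N1 + N2) * (p1 M * p2 M)"
      by (simp add: power_add)
  qed (intro poly_fun.mult *(1,2))
qed

text \<open>A rational map e / d sends the closure of S into the closure of T when it sends S into
  T: the numerator of the pullback of an equation of T is an equation of S, and at A the factor
  d(A)^N can be cancelled.\<close>

lemma zariski_closure_mat_map:
  assumes d: "d \<in> poly_fun m"
    and e: "\<And>i j. i < m \<Longrightarrow> j < m \<Longrightarrow> e i j \<in> poly_fun m"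
    and S: "\<And>B. B \<in> S \<Longrightarrow> \<exists>M\<in>T. \<forall>i<m. \<forall>j<m. d B * M $$ (i, j) = e i j B"
    and A: "A \<in> zariski_closure_mat m S" "d A \<noteq> 0"
    and M: "M \<in> carrier_mat m m" "\<And>i j. i < m \<Longrightarrow> j < m \<Longrightarrow> d A * M $$ (i, j) = e i j A"
  shows "M \<in> zariski_closure_mat m T"
  unfolding zariski_closure_mat_def
proof (intro CollectI conjI ballI impI M(1))
  fix p assume p: "p \<in> poly_fun m" and p0: "\<forall>B\<in>T. p B = 0"
  obtain N p' where p': "p' \<in> poly_fun m"
    "\<And>A M. (\<forall>i<m. \<forall>j<m. d A * M $$ (i, j) = e i j A) \<Longrightarrow> p' A = d A ^ N * p M"
    using poly_fun_quotient[of p m d e, OF p d e] by blast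
  have "p' B = 0" if B: "B \<in> S" for B
  proof -
    obtain M' where "M' \<in> T" "\<forall>i<m. \<forall>j<m. d B * M' $$ (i, j) = e i j B"
      using S[OF B] by blast
    with p'(2)[of B M'] p0 show ?thesis by simp
  qed
  then have "p' A = 0" using A(1) p'(1) by (auto simp: zariski_closure_mat_def)
  moreover have "p' A = d A ^ N * p M" using p'(2) M(2) by blast
  ultimately show "p M = 0" using A(2) by simp
qed

lemma zariski_closure_mat_mult_left:
  assumes P: "P \<in> carrier_mat m m" and S: "S \<subseteq> carrier_mat m m"
    and PS: "\<And>B. B \<in> S \<Longrightarrow> P * B \<in> T"
    and A: "A \<in> zariski_closure_mat m S"
  shows "P * A \<in> zariski_closure_mat m T"
proof (rule zariski_closure_mat_map[where d = "\<lambda>A. 1" and S = S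
      and e = "\<lambda>i j A. \<Sum>x<m. P $$ (i, x) * A $$ (x, j)"])
  have AC: "A \<in> carrier_mat m m" using A by (rule zariski_closure_mat_carrier)
  show "P * A \<in> carrier_mat m m" using P AC by simp
  show "1 * (P * A) $$ (i, j) = (\<Sum>x<m. P $$ (i, x) * A $$ (x, j))" if "i < m" "j < m" for i j
    using index_mult_mat_sum[OF P AC that] by simp
  show "\<exists>M\<in>T. \<forall>i<m. \<forall>j<m. 1 * M $$ (i, j) = (\<Sum>x<m. P $$ (i, x) * B $$ (x, j))"
    if "B \<in> S" for B
    using PS[OF that] index_mult_mat_sum[OF P, of B m] S that
    by (intro bexI[of _ "P * B"]) auto
qed (auto intro!: poly_fun_sum poly_fun_scale poly_fun.entry poly_fun.const simp: A)

lemma zariski_closure_mat_mult_right: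
  assumes P: "P \<in> carrier_mat m m" and S: "S \<subseteq> carrier_mat m m"
    and PS: "\<And>B. B \<in> S \<Longrightarrow> B * P \<in> T"
    and A: "A \<in> zariski_closure_mat m S"
  shows "A * P \<in> zariski_closure_mat m T"
proof (rule zariski_closure_mat_map[where d = "\<lambda>A. 1" and S = S
      and e = "\<lambda>i j A. \<Sum>x<m. A $$ (i, x) * P $$ (x, j)"])
  have AC: "A \<in> carrier_mat m m" using A by (rule zariski_closure_mat_carrier)
  show "A * P \<in> carrier_mat m m" using P AC by simp
  show "1 * (A * P) $$ (i, j) = (\<Sum>x<m. A $$ (i, x) * P $$ (x, j))" if "i < m" "j < m" for i j
    using index_mult_mat_sum[OF AC P that] by simp
  show "\<exists>M\<in>T. \<forall>i<m. \<forall>j<m. 1 * M $$ (i, j) = (\<Sum>x<m. B $$ (i, x) * P $$ (x, j))"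
    if "B \<in> S" for B
    using PS[OF that] index_mult_mat_sum[OF _ P, of B m] S that
    by (intro bexI[of _ "B * P"]) auto
qed (auto intro!: poly_fun_sum poly_fun.mult poly_fun.entry poly_fun.const simp: A)

text \<open>Multiplication is extended to the closure one factor at a time: the right factor is
  moved into the closure while the left one stays in S, then the left factor follows.\<close>

lemma zariski_closure_mat_mult_closed:
  assumes S: "S \<subseteq> carrier_mat m m"
    and mult: "\<And>A B. A \<in> S \<Longrightarrow> B \<in> S \<Longrightarrow> A * B \<in> S"
    and A: "A \<in> zariski_closure_mat m S" and B: "B \<in> zariski_closure_mat m S"
  shows "A * B \<in> zariski_closure_mat m S"
proof -
  have BC: "B \<in> carrier_mat m m" using B by (rule zariski_closure_mat_carrier)
  have "X * B \<in> zariski_closure_mat m S" if "X \<in> S" for X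
    by (rule zariski_closure_mat_mult_left[OF _ S _ B]) (use that S mult in auto)
  from zariski_closure_mat_mult_right[OF BC S this A]
  show ?thesis by (simp add: zariski_closure_mat_idem)
qed

text \<open>The value of \<open>det\<close> depends on the dimensions stored in its argument, so
  what is polynomial is the Leibniz expansion of fixed size m, which agrees with \<open>det\<close>
  on m x m matrices.\<close>

lemma poly_fun_det: "\<exists>d\<in>poly_fun m. \<forall>A\<in>carrier_mat m m. d A = det A"
proof
  show "(\<lambda>A. \<Sum>p\<in>{p. p permutes {0..<m}}. signof p * (\<Prod>i\<in>{0..<m}. A $$ (i, p i))) \<in> poly_fun m"
    by (intro poly_fun_sum poly_fun_scale poly_fun_prod poly_fun.entry) auto
qed (auto simp: det_def')

lemma poly_fun_adj_entry:
  assumes "i < m" "j < m"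
  shows "\<exists>e\<in>poly_fun m. \<forall>A\<in>carrier_mat m m. e A = adj_mat A $$ (i, j)"
proof
  define k where "k = m - 1"
  \<comment> \<open>Entry (i, j) of the adjugate is the cofactor at (j, i); \<open>?f\<close>
    translates indices of the minor back to A by skipping row j and column i.\<close>
  let ?f = "\<lambda>a b. (if a < j then a else Suc a, if b < i then b else Suc b)"
  show "(\<lambda>A. (-1) ^ (j + i) * (\<Sum>p\<in>{p. p permutes {0..<k}}. signof p *
     (\<Prod>a\<in>{0..<k}. A $$ ?f a (p a)))) \<in> poly_fun m"
  proof (intro poly_fun_sum poly_fun_scale poly_fun_prod)
    fix p a assume "p \<in> {p. p permutes {0..<k}}" "a \<in> {0..<k}"
    then have "a < k" "p a < k" using permutes_in_image[of p "{0..<k}" a] by auto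
    then show "(\<lambda>A. A $$ ?f a (p a)) \<in> poly_fun m"
      using assms by (auto intro!: poly_fun.entry simp: k_def)
  qed
  show "\<forall>A\<in>(carrier_mat m m :: complex mat set). (-1) ^ (j + i) * (\<Sum>p\<in>{p. p permutes {0..<k}}. signof p *
     (\<Prod>a\<in>{0..<k}. A $$ ?f a (p a))) = adj_mat A $$ (i, j)"
  proof
    fix A :: "complex mat" assume A: "A \<in> carrier_mat m m"
    have "det (mat_delete A j i) = (\<Sum>p\<in>{p. p permutes {0..<k}}. signof p *
      (\<Prod>a\<in>{0..<k}. mat_delete A j i $$ (a, p a)))"
      by (rule det_def') (use A in \<open>auto simp: k_def mat_delete_def\<close>)
    also have "\<dots> = (\<Sum>p\<in>{p. p permutes {0..<k}}. signof p * (\<Prod>a\<in>{0..<k}. A $$ ?f a (p a)))"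
    proof (intro sum.cong refl arg_cong[where f = "\<lambda>x. _ * x"] prod.cong)
      fix p a assume "p \<in> {p. p permutes {0..<k}}" "a \<in> {0..<k}"
      then have "a < k" "p a < k" using permutes_in_image[of p "{0..<k}" a] by auto
      then show "mat_delete A j i $$ (a, p a) = A $$ ?f a (p a)"
        using A by (simp add: mat_delete_def k_def)
    qed
    finally show "(-1) ^ (j + i) * (\<Sum>p\<in>{p. p permutes {0..<k}}. signof p *
     (\<Prod>a\<in>{0..<k}. A $$ ?f a (p a))) = adj_mat A $$ (i, j)"
      using A assms by (simp add: adj_mat_def cofactor_def)
  qed
qed

lemma left_inverse_mat_exists:
  fixes A :: "complex mat"
  assumes A: "A \<in> carrier_mat m m" and detA: "det A \<noteq> 0"
  obtains B where "B \<in> carrier_mat m m" "B * A = 1\<^sub>m m"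
proof
  let ?B = "(1 / det A) \<cdot>\<^sub>m adj_mat A"
  note adj = adj_mat[OF A]
  show "?B \<in> carrier_mat m m" using adj(1) by simp
  have "?B * A = (1 / det A) \<cdot>\<^sub>m (adj_mat A * A)"
    by (rule mult_smult_assoc_mat[OF adj(1) A])
  also have "\<dots> = 1\<^sub>m m"
    unfolding adj(3) by (rule eq_matI) (use detA in auto)
  finally show "?B * A = 1\<^sub>m m" .
qed

text \<open>Cramer's rule without division, in the shape required for maps with common denominator
  \<open>det A\<close>.\<close>

lemma index_right_inverse_mat:
  fixes A :: "complex mat"
  assumes A: "A \<in> carrier_mat m m" and B: "B \<in> carrier_mat m m" and AB: "A * B = 1\<^sub>m m"
    and ij: "i < m" "j < m"
  shows "det A * B $$ (i, j) = adj_mat A $$ (i, j)"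
proof -
  note adj = adj_mat[OF A]
  have "det A \<cdot>\<^sub>m B = det A \<cdot>\<^sub>m (1\<^sub>m m * B)" using B by simp
  also have "\<dots> = adj_mat A * A * B"
    unfolding adj(3) by (rule mult_smult_assoc_mat[OF one_carrier_mat B, symmetric])
  also have "\<dots> = adj_mat A"
    using assoc_mult_mat[OF adj(1) A B] adj(1) by (simp add: AB)
  finally have "(det A \<cdot>\<^sub>m B) $$ (i, j) = adj_mat A $$ (i, j)" by simp
  then show ?thesis using B ij by simp
qed

subsection \<open>Perturbations of a single row\<close>

definition polynomial_fun :: "(complex \<Rightarrow> complex) \<Rightarrow> bool" where
  "polynomial_fun f \<longleftrightarrow> (\<exists>P. \<forall>t. f t = poly P t)"

lemma polynomial_fun_const [intro!]: "polynomial_fun (\<lambda>t. c)"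
  unfolding polynomial_fun_def by (rule exI[of _ "[:c:]"]) simp

lemma polynomial_fun_ident [intro!]: "polynomial_fun (\<lambda>t. t)"
  unfolding polynomial_fun_def by (rule exI[of _ "[:0, 1:]"]) simp

lemma polynomial_fun_add [intro!]:
  "polynomial_fun f \<Longrightarrow> polynomial_fun g \<Longrightarrow> polynomial_fun (\<lambda>t. f t + g t)"
  unfolding polynomial_fun_def by (metis poly_add)

lemma polynomial_fun_diff [intro!]:
  "polynomial_fun f \<Longrightarrow> polynomial_fun g \<Longrightarrow> polynomial_fun (\<lambda>t. f t - g t)"
  unfolding polynomial_fun_def by (metis poly_diff)

lemma polynomial_fun_mult [intro!]:
  "polynomial_fun f \<Longrightarrow> polynomial_fun g \<Longrightarrow> polynomial_fun (\<lambda>t. f t * g t)"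
  unfolding polynomial_fun_def by (metis poly_mult)

lemma polynomial_fun_if [intro!]:
  "polynomial_fun f \<Longrightarrow> polynomial_fun g \<Longrightarrow> polynomial_fun (\<lambda>t. if c then f t else g t)"
  by (cases c) simp_all

text \<open>An equation of S restricted to a polynomial curve is a polynomial in t; infinitely many
  zeros make it vanish identically. This replaces limits and fills in exceptional
  parameters.\<close>

lemma zariski_closure_mat_curve:
  assumes \<gamma>: "\<And>t. \<gamma> t \<in> carrier_mat m m"
    and entries: "\<And>i j. i < m \<Longrightarrow> j < m \<Longrightarrow> polynomial_fun (\<lambda>t. \<gamma> t $$ (i, j))"
    and inf: "infinite {t. \<gamma> t \<in> zariski_closure_mat m S}"
  shows "\<gamma> t \<in> zariski_closure_mat m S"
  unfolding zariski_closure_mat_def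
proof (intro CollectI conjI ballI impI \<gamma>)
  fix p assume "p \<in> poly_fun m" and p0: "\<forall>B\<in>S. p B = 0"
  from this(1) have "polynomial_fun (\<lambda>t. p (\<gamma> t))"
    by induction (auto intro: entries)
  then obtain P where P: "\<And>t. p (\<gamma> t) = poly P t"
    by (auto simp: polynomial_fun_def)
  have "{t. \<gamma> t \<in> zariski_closure_mat m S} \<subseteq> {t. poly P t = 0}"
    using \<open>p \<in> poly_fun m\<close> p0 by (auto simp: zariski_closure_mat_def P[symmetric])
  then have "P = 0" using inf finite_subset poly_roots_finite by blast
  then show "p (\<gamma> t) = 0" by (simp add: P)
qed

text \<open>The matrix of I + f_i \<phi> in the basis f: a linear form is stored as the function of
  its values \<phi> b on the basis vectors, so \<phi> i stands for \<phi>(f_i).\<close>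

definition row_pert :: "nat \<Rightarrow> nat \<Rightarrow> (nat \<Rightarrow> complex) \<Rightarrow> complex mat" where
  "row_pert m i \<phi> = mat m m (\<lambda>(a, b). (if a = b then 1 else 0) + (if a = i then \<phi> b else 0))"

lemma row_pert_carrier [simp]: "row_pert m i \<phi> \<in> carrier_mat m m"
  and row_pert_dim [simp]: "dim_row (row_pert m i \<phi>) = m" "dim_col (row_pert m i \<phi>) = m"
  by (simp_all add: row_pert_def)

lemma index_row_pert [simp]:
  "a < m \<Longrightarrow> b < m \<Longrightarrow> row_pert m i \<phi> $$ (a, b) = (if a = b then 1 else 0) + (if a = i then \<phi> b else 0)"
  by (simp add: row_pert_def)

lemma row_pert_cong: "(\<And>b. b < m \<Longrightarrow> \<phi> b = \<psi> b) \<Longrightarrow> row_pert m i \<phi> = row_pert m i \<psi>"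
  by (auto simp: row_pert_def)

lemma row_pert_zero: "row_pert m i (\<lambda>b. 0) = 1\<^sub>m m"
  by (rule eq_matI) auto

lemma index_row_pert_mult:
  assumes A: "A \<in> carrier_mat m m" and ab: "a < m" "b < m"
  shows "(row_pert m i \<phi> * A) $$ (a, b) =
    A $$ (a, b) + (if a = i then \<Sum>x<m. \<phi> x * A $$ (x, b) else 0)"
proof -
  have "(row_pert m i \<phi> * A) $$ (a, b) =
      (\<Sum>x<m. (if x = a then A $$ (x, b) else 0) + (if a = i then \<phi> x * A $$ (x, b) else 0))"
    using index_mult_mat_sum[OF _ A ab, of "row_pert m i \<phi>"] ab
    by (auto intro!: sum.cong simp: algebra_simps)
  also have "\<dots> = A $$ (a, b) + (\<Sum>x<m. if a = i then \<phi> x * A $$ (x, b) else 0)"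
    using ab by (simp add: sum.distrib sum.delta)
  finally show ?thesis by simp
qed

lemma index_row_pert_mult_row_pert:
  assumes ab: "a < m" "b < m" and i: "i < m"
  shows "(row_pert m j \<psi> * row_pert m i \<phi>) $$ (a, b) =
    (if a = b then 1 else 0) + (if a = i then \<phi> b else 0) + (if a = j then \<psi> b + \<psi> i * \<phi> b else 0)"
proof -
  have "(\<Sum>x<m. \<psi> x * row_pert m i \<phi> $$ (x, b)) =
      (\<Sum>x<m. (if x = b then \<psi> x else 0) + (if x = i then \<psi> x * \<phi> b else 0))"
    using ab by (intro sum.cong) (auto simp: algebra_simps)
  also have "\<dots> = \<psi> b + \<psi> i * \<phi> b"
    using ab i by (simp add: sum.distrib sum.delta)
  finally show ?thesis
    using index_row_pert_mult[of "row_pert m i \<phi>" m a b j \<psi>] ab by auto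
qed

lemma row_pert_mult_same:
  assumes "i < m"
  shows "row_pert m i \<psi> * row_pert m i \<phi> = row_pert m i (\<lambda>b. \<phi> b + \<psi> b + \<psi> i * \<phi> b)"
  by (rule eq_matI) (use assms in \<open>auto simp: index_row_pert_mult_row_pert simp del: index_mult_mat(1)\<close>)

lemma index_row_pert_triple:
  assumes ab: "a < m" "b < m" and ij: "i < m" "j < m"
  shows "(row_pert m i \<chi> * (row_pert m j \<psi> * row_pert m i \<phi>)) $$ (a, b) =
    (if a = b then 1 else 0) + (if a = j then \<psi> b + \<psi> i * \<phi> b else 0)
    + (if a = i then \<phi> b + \<chi> b + \<chi> i * \<phi> b + \<chi> j * (\<psi> b + \<psi> i * \<phi> b) else 0)"
proof -
  have "(\<Sum>x<m. \<chi> x * (row_pert m j \<psi> * row_pert m i \<phi>) $$ (x, b)) =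
      (\<Sum>x<m. (if x = b then \<chi> x else 0) + (if x = i then \<chi> x * \<phi> b else 0)
         + (if x = j then \<chi> x * (\<psi> b + \<psi> i * \<phi> b) else 0))"
  proof (rule sum.cong[OF refl])
    fix x assume "x \<in> {..<m}"
    then have x: "x < m" by simp
    show "\<chi> x * (row_pert m j \<psi> * row_pert m i \<phi>) $$ (x, b) =
      (if x = b then \<chi> x else 0) + (if x = i then \<chi> x * \<phi> b else 0)
         + (if x = j then \<chi> x * (\<psi> b + \<psi> i * \<phi> b) else 0)"
      unfolding index_row_pert_mult_row_pert[OF x ab(2) ij(1)] by (simp add: distrib_left)
  qed
  also have "\<dots> = \<chi> b + \<chi> i * \<phi> b + \<chi> j * (\<psi> b + \<psi> i * \<phi> b)"
    using ab ij by (simp add: sum.distrib sum.delta)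
  finally show ?thesis
    unfolding index_row_pert_mult[OF mult_carrier_mat[OF row_pert_carrier row_pert_carrier] ab]
      index_row_pert_mult_row_pert[OF ab ij(1)] by simp
qed

section \<open>One-parameter families of row perturbations in the closure\<close>

text \<open>For Z the closure this is the space V_i of the overview. Requiring all multiples t at
  once gives closure under scaling immediately; closure under addition needs an argument.\<close>

definition row_dirs :: "nat \<Rightarrow> complex mat set \<Rightarrow> nat \<Rightarrow> (nat \<Rightarrow> complex) set" where
  "row_dirs m Z i = {\<phi>. \<forall>t. row_pert m i (\<lambda>b. t * \<phi> b) \<in> Z}"

lemma row_dirs_scale: "\<phi> \<in> row_dirs m Z i \<Longrightarrow> (\<lambda>b. c * \<phi> b) \<in> row_dirs m Z i"
  by (auto simp: row_dirs_def mult.assoc[symmetric])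

locale mat_monoid =
  fixes m :: nat and S :: "complex mat set"
  assumes S_carrier: "S \<subseteq> carrier_mat m m"
    and S_one: "1\<^sub>m m \<in> S"
    and S_mult: "\<And>A B. A \<in> S \<Longrightarrow> B \<in> S \<Longrightarrow> A * B \<in> S"
begin

abbreviation "Z \<equiv> zariski_closure_mat m S"

lemmas Z_mult = zariski_closure_mat_mult_closed[OF S_carrier S_mult]

lemma Z_one: "1\<^sub>m m \<in> Z"
  using S_one subset_zariski_closure_mat[OF S_carrier] by blast

text \<open>The product of I + t f_i \<phi> and I + s f_i \<psi> is I + f_i (t \<phi> + s (1 + t
  \<phi>(f_i)) \<psi>), so a suitable s turns it into the family of \<phi> + \<psi>. At most one t
  has to be left out, and the curve argument restores it.\<close>

lemma row_dirs_add:
  assumes i: "i < m" and \<phi>: "\<phi> \<in> row_dirs m Z i" and \<psi>: "\<psi> \<in> row_dirs m Z i"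
  shows "(\<lambda>b. \<phi> b + \<psi> b) \<in> row_dirs m Z i"
proof -
  let ?\<gamma> = "\<lambda>t. row_pert m i (\<lambda>b. t * (\<phi> b + \<psi> b))"
  have *: "?\<gamma> t \<in> Z" if t: "1 + t * \<phi> i \<noteq> 0" for t
  proof -
    define s where "s = t / (1 + t * \<phi> i)"
    have s: "s * (1 + t * \<phi> i) = t" using t by (simp add: s_def)
    have "row_pert m i (\<lambda>b. t * \<phi> b) * row_pert m i (\<lambda>b. s * \<psi> b) \<in> Z"
      using \<phi> \<psi> by (intro Z_mult) (auto simp: row_dirs_def)
    also have "row_pert m i (\<lambda>b. t * \<phi> b) * row_pert m i (\<lambda>b. s * \<psi> b) = ?\<gamma> t"
      unfolding row_pert_mult_same[OF i]
    proof (rule row_pert_cong)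
      fix b
      have "s * \<psi> b + t * \<phi> b + t * \<phi> i * (s * \<psi> b) = t * \<phi> b + (s * (1 + t * \<phi> i)) * \<psi> b"
        by (simp add: algebra_simps)
      also have "\<dots> = t * (\<phi> b + \<psi> b)"
        unfolding s by (simp add: algebra_simps)
      finally show "s * \<psi> b + t * \<phi> b + t * \<phi> i * (s * \<psi> b) = t * (\<phi> b + \<psi> b)" .
    qed
    finally show ?thesis .
  qed
  have "{t. 1 + t * \<phi> i = 0} \<subseteq> {- 1 / \<phi> i}"
  proof clarsimp
    fix x assume "1 + x * \<phi> i = 0"
    then have "x * \<phi> i = - 1" "\<phi> i \<noteq> 0" by (auto simp: add_eq_0_iff)
    then have "x = - 1 / \<phi> i" by (simp only: eq_divide_eq) simp
    then show "x = - (1 / \<phi> i)" by simp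
  qed
  then have "finite {t. 1 + t * \<phi> i = 0}" using finite_subset by blast
  then have "infinite (- {t. 1 + t * \<phi> i = 0})"
    using infinite_UNIV_char_0 by (metis finite_compl)
  moreover have "- {t. 1 + t * \<phi> i = 0} \<subseteq> {t. ?\<gamma> t \<in> Z}" using * by auto
  ultimately have "infinite {t. ?\<gamma> t \<in> Z}" using finite_subset by blast
  then have "?\<gamma> t \<in> Z" for t
    by (rule zariski_closure_mat_curve[rotated 2]) auto
  then show ?thesis by (auto simp: row_dirs_def)
qed

lemma row_dirs_sum:
  assumes "i < m" "finite J" "\<And>j. j \<in> J \<Longrightarrow> \<phi> j \<in> row_dirs m Z i"
  shows "(\<lambda>b. \<Sum>j\<in>J. c j * \<phi> j b) \<in> row_dirs m Z i"
  using assms(2,3)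
proof (induction J rule: finite_induct)
  case empty
  then show ?case using Z_one by (simp add: row_dirs_def row_pert_zero)
next
  case (insert j J)
  then show ?case
    using row_dirs_add[OF assms(1) row_dirs_scale[of "\<phi> j" m Z i "c j"], of "\<lambda>b. \<Sum>j\<in>J. c j * \<phi> j b"]
    by simp
qed

text \<open>Conjugating I + w' f_j \<psi> by I + f_i \<phi> / r gives I + w' (f_j + \<phi>(f_j) f_i
  / r) (\<psi> - \<psi>(f_i) \<phi> / (r + \<phi>(f_i))). Putting w' = w r (r + \<phi>(f_i)) clears
  both denominators, and at r = 0 the vector f_j disappears: what remains is a perturbation along
  f_i with form \<phi>(f_i) \<psi> - \<psi>(f_i) \<phi>. Its second term lies in V_i already, so
  \<psi> does as well.\<close>

lemma row_dirs_transfer: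
  assumes ij: "i < m" "j < m" "i \<noteq> j"
    and \<phi>: "\<phi> \<in> row_dirs m Z i" "\<phi> i \<noteq> 0" "\<phi> j \<noteq> 0"
    and \<psi>: "\<psi> \<in> row_dirs m Z j"
  shows "\<psi> \<in> row_dirs m Z i"
proof -
  \<comment> \<open>The conjugate after clearing denominators; it is polynomial in r and therefore
    defined at r = 0, where the conjugating matrix is not.\<close>
  define \<gamma> where "\<gamma> w r = mat m m (\<lambda>(a, b). (if a = b then 1 else 0)
      + w * ((if a = j then r else 0) + (if a = i then \<phi> j else 0)) *
          ((r + \<phi> i) * \<psi> b - \<psi> i * \<phi> b))" for w r
  have *: "\<gamma> w r \<in> Z" if r: "r \<noteq> 0" "r + \<phi> i \<noteq> 0" for w r
  proof -
    \<comment> \<open>The factor with - 1 / (r + \<phi> i) is the inverse of the one with 1 /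
      r.\<close>
    let ?M = "row_pert m i (\<lambda>b. (1 / r) * \<phi> b) *
        (row_pert m j (\<lambda>b. (w * r * (r + \<phi> i)) * \<psi> b) * row_pert m i (\<lambda>b. (- 1 / (r + \<phi> i)) * \<phi> b))"
    have "?M \<in> Z"
      using \<phi>(1) \<psi> by (intro Z_mult) (auto simp only: row_dirs_def mem_Collect_eq)
    also have "?M = \<gamma> w r"
    proof (rule eq_matI)
      fix a b assume "a < dim_row (\<gamma> w r)" "b < dim_col (\<gamma> w r)"
      then have ab: "a < m" "b < m" by (simp_all add: \<gamma>_def)
      have k1: "(w * r * (r + \<phi> i)) * \<psi> b + (w * r * (r + \<phi> i)) * \<psi> i * ((- 1 / (r + \<phi> i)) * \<phi> b)
          = w * r * ((r + \<phi> i) * \<psi> b - \<psi> i * \<phi> b)"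
        using r by (simp add: field_simps)
      have "(- 1 / (r + \<phi> i)) * \<phi> b + (1 / r) * \<phi> b + (1 / r) * \<phi> i * ((- 1 / (r + \<phi> i)) * \<phi> b) = 0"
        using r by (simp add: divide_simps) (simp add: algebra_simps)
      moreover have "(1 / r) * \<phi> j * (w * r * ((r + \<phi> i) * \<psi> b - \<psi> i * \<phi> b))
          = w * \<phi> j * ((r + \<phi> i) * \<psi> b - \<psi> i * \<phi> b)"
        using r by simp
      ultimately have k2: "(- 1 / (r + \<phi> i)) * \<phi> b + (1 / r) * \<phi> b
          + (1 / r) * \<phi> i * ((- 1 / (r + \<phi> i)) * \<phi> b)
          + (1 / r) * \<phi> j * (w * r * ((r + \<phi> i) * \<psi> b - \<psi> i * \<phi> b))
          = w * \<phi> j * ((r + \<phi> i) * \<psi> b - \<psi> i * \<phi> b)"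
        by simp
      show "?M $$ (a, b) = \<gamma> w r $$ (a, b)"
        unfolding index_row_pert_triple[OF ab ij(1,2)] k1 k2 using ab ij(3)
        by (simp add: \<gamma>_def)
    qed (simp_all add: \<gamma>_def)
    finally show ?thesis .
  qed
  have "infinite (UNIV - {0, - \<phi> i})"
    using infinite_UNIV_char_0 by (simp add: Diff_infinite_finite)
  moreover have "UNIV - {0, - \<phi> i} \<subseteq> {r. \<gamma> w r \<in> Z}" for w
    using * by (auto simp: add_eq_0_iff2)
  ultimately have inf: "infinite {r. \<gamma> w r \<in> Z}" for w using finite_subset by blast
  have "\<gamma> w 0 \<in> Z" for w
  proof (rule zariski_closure_mat_curve[OF _ _ inf])
    fix a b assume "a < m" "b < m"
    then show "polynomial_fun (\<lambda>t. \<gamma> w t $$ (a, b))"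
      by (cases "a = i"; cases "a = j") (auto simp: \<gamma>_def)
  qed (simp add: \<gamma>_def)
  \<comment> \<open>Setting w = t / \<phi> j normalises the coefficient w \<phi> j of f_i to the
    free parameter t.\<close>
  then have "\<gamma> (t / \<phi> j) 0 \<in> Z" for t .
  moreover have "\<gamma> (t / \<phi> j) 0 = row_pert m i (\<lambda>b. t * (\<phi> i * \<psi> b - \<psi> i * \<phi> b))" for t
    using \<phi>(3) by (auto simp: \<gamma>_def row_pert_def)
  ultimately have "(\<lambda>b. \<phi> i * \<psi> b - \<psi> i * \<phi> b) \<in> row_dirs m Z i"
    by (simp add: row_dirs_def)
  from row_dirs_add[OF ij(1) this row_dirs_scale[OF \<phi>(1), of "\<psi> i"]]
  have "(\<lambda>b. \<phi> i * \<psi> b) \<in> row_dirs m Z i" by simp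
  from row_dirs_scale[OF this, of "1 / \<phi> i"] \<phi>(2) show ?thesis by simp
qed

lemma row_pert_in_closure:
  assumes \<phi>: "\<And>i. i < m \<Longrightarrow> \<phi> i \<in> row_dirs m Z i"
    and diag: "\<And>i. i < m \<Longrightarrow> \<phi> i i \<noteq> 0"
    and neigh: "\<And>i. Suc i < m \<Longrightarrow> \<phi> i (Suc i) \<noteq> 0" "\<And>i. Suc i < m \<Longrightarrow> \<phi> (Suc i) i \<noteq> 0"
    and det: "det (mat m m (\<lambda>(i, j). \<phi> i j)) \<noteq> 0" and i: "i < m"
  shows "row_pert m i \<psi> \<in> Z"
proof -
  define A where "A = mat m m (\<lambda>(i, j). \<phi> i j)"
  have A: "A \<in> carrier_mat m m" and A_index: "\<And>i j. i < m \<Longrightarrow> j < m \<Longrightarrow> A $$ (i, j) = \<phi> i j"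
    by (simp_all add: A_def)
  have eq0: "row_dirs m Z i = row_dirs m Z 0" if "i < m" for i
    using that
  proof (induction i)
    case (Suc i)
    then have i: "i < m" "Suc i < m" "i \<noteq> Suc i" "Suc i \<noteq> i" by simp_all
    have "row_dirs m Z (Suc i) \<subseteq> row_dirs m Z i"
      using row_dirs_transfer[OF i(1,2,3) \<phi>[OF i(1)] diag[OF i(1)] neigh(1)[OF i(2)]] by blast
    moreover have "row_dirs m Z i \<subseteq> row_dirs m Z (Suc i)"
      using row_dirs_transfer[OF i(2,1,4) \<phi>[OF i(2)] diag[OF i(2)] neigh(2)[OF i(2)]] by blast
    ultimately show ?case using Suc.IH[OF i(1)] by simp
  qed simp
  have detA: "det A \<noteq> 0" using det unfolding A_def .
  obtain C where C: "C \<in> carrier_mat m m" "C * A = 1\<^sub>m m"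
    using left_inverse_mat_exists[OF A detA] .
  \<comment> \<open>The coordinates of \<psi> in the basis formed by the \<phi> j: the row vector
    \<psi> times the inverse of the matrix with rows \<phi> j.\<close>
  define c where "c j = (\<Sum>a<m. \<psi> a * C $$ (a, j))" for j
  have "\<phi> j \<in> row_dirs m Z i" if "j \<in> {..<m}" for j
    using \<phi>[of j] that eq0[OF i] eq0[of j] by simp
  then have "(\<lambda>b. \<Sum>j<m. c j * \<phi> j b) \<in> row_dirs m Z i"
    by (rule row_dirs_sum[OF i finite_lessThan])
  then have "row_pert m i (\<lambda>b. 1 * (\<Sum>j<m. c j * \<phi> j b)) \<in> Z"
    unfolding row_dirs_def by blast
  also have "row_pert m i (\<lambda>b. 1 * (\<Sum>j<m. c j * \<phi> j b)) = row_pert m i \<psi>"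
  proof (rule row_pert_cong)
    fix b assume b: "b < m"
    have "(\<Sum>j<m. c j * \<phi> j b) = (\<Sum>j<m. \<Sum>a<m. \<psi> a * (C $$ (a, j) * \<phi> j b))"
      by (simp add: c_def sum_distrib_right mult.assoc)
    also have "\<dots> = (\<Sum>a<m. \<psi> a * (\<Sum>j<m. C $$ (a, j) * \<phi> j b))"
      by (subst sum.swap) (simp add: sum_distrib_left)
    also have "\<dots> = (\<Sum>a<m. \<psi> a * (C * A) $$ (a, b))"
      using b by (intro sum.cong refl) (simp add: index_mult_mat_sum[OF C(1) A] A_index del: index_mult_mat(1))
    also have "\<dots> = (\<Sum>a<m. if a = b then \<psi> a else 0)"
      unfolding C(2) using b by (intro sum.cong) auto
    also have "\<dots> = \<psi> b" using b by (simp add: sum.delta)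
    finally show "1 * (\<Sum>j<m. c j * \<phi> j b) = \<psi> b" by simp
  qed
  finally show ?thesis .
qed

end

subsection \<open>Commutators and transvections\<close>

text \<open>The map A \<mapsto> A Q A^(-1) is rational with denominator \<open>det A\<close> and
  numerator A Q adj(A), so it carries closures to closures.\<close>

lemma zariski_closure_mat_conj:
  assumes S: "S \<subseteq> carrier_mat m m" and Q: "Q \<in> carrier_mat m m"
    and T: "\<And>B. B \<in> S \<Longrightarrow> \<exists>B'\<in>carrier_mat m m. B * B' = 1\<^sub>m m \<and> B * Q * B' \<in> T"
    and A: "A \<in> zariski_closure_mat m S" "A' \<in> carrier_mat m m" "A * A' = 1\<^sub>m m"
  shows "A * Q * A' \<in> zariski_closure_mat m T"
proof -
  obtain d where d: "d \<in> poly_fun m" "\<And>A. A \<in> carrier_mat m m \<Longrightarrow> d A = det A"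
    using poly_fun_det by blast
  have "\<forall>i j. \<exists>e. i < m \<longrightarrow> j < m \<longrightarrow>
      e \<in> poly_fun m \<and> (\<forall>A\<in>carrier_mat m m. e A = adj_mat A $$ (i, j))"
    using poly_fun_adj_entry by blast
  then obtain ad where "\<forall>i j. i < m \<longrightarrow> j < m \<longrightarrow>
      ad i j \<in> poly_fun m \<and> (\<forall>A\<in>carrier_mat m m. ad i j A = adj_mat A $$ (i, j))"
    by metis
  then have ad: "\<And>i j. i < m \<Longrightarrow> j < m \<Longrightarrow> ad i j \<in> poly_fun m"
    "\<And>i j A. i < m \<Longrightarrow> j < m \<Longrightarrow> A \<in> carrier_mat m m \<Longrightarrow> ad i j A = adj_mat A $$ (i, j)"
    by blast+
  let ?e = "\<lambda>i j A. \<Sum>z<m. (\<Sum>y<m. A $$ (i, y) * Q $$ (y, z)) * ad z j A"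
  have AC: "A \<in> carrier_mat m m" using A(1) by (rule zariski_closure_mat_carrier)
  have e: "d B * (B * Q * B') $$ (i, j) = ?e i j B"
    if B: "B \<in> carrier_mat m m" "B' \<in> carrier_mat m m" "B * B' = 1\<^sub>m m" and ij: "i < m" "j < m"
    for B B' i j
  proof -
    have "d B * (B * Q * B') $$ (i, j) = (\<Sum>z<m. (B * Q) $$ (i, z) * (det B * B' $$ (z, j)))"
      using index_mult_mat_sum[OF mult_carrier_mat[OF B(1) Q] B(2) ij]
      by (simp add: d(2)[OF B(1)] sum_distrib_left mult.left_commute del: index_mult_mat(1))
    also have "\<dots> = ?e i j B"
      using index_right_inverse_mat[OF B] index_mult_mat_sum[OF B(1) Q ij(1)] ij
      by (intro sum.cong) (simp_all add: ad(2) B(1) del: index_mult_mat(1))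
    finally show ?thesis .
  qed
  show ?thesis
  proof (rule zariski_closure_mat_map[where d = d and e = ?e and S = S])
    show "d \<in> poly_fun m" by (rule d)
    show "?e i j \<in> poly_fun m" if "i < m" "j < m" for i j
      by (intro poly_fun_sum poly_fun.mult poly_fun.entry poly_fun.const ad) (use that in auto)
    show "\<exists>M\<in>T. \<forall>i<m. \<forall>j<m. d B * M $$ (i, j) = ?e i j B" if "B \<in> S" for B
      using T[OF that] e[of B] S that by blast
    show "A \<in> zariski_closure_mat m S" by (rule A)
    have "det A * det A' = 1" using det_mult[OF AC A(2)] A(3) by simp
    then show "d A \<noteq> 0" using d(2)[OF AC] by auto
    show "A * Q * A' \<in> carrier_mat m m" using AC Q A(2) by simp
    show "d A * (A * Q * A') $$ (i, j) = ?e i j A" if "i < m" "j < m" for i j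
      by (rule e[OF AC A(2,3) that])
  qed
qed

text \<open>A commutator is a conjugate times a fixed matrix in either variable: (x z x^(-1)) z^(-1)
  when x varies, x (y x^(-1) y^(-1)) when y varies. So x is moved into the closure first, against z
  in S, and y afterwards; the fixed outer factor is absorbed into the target set
  \<open>?T\<close>.\<close>

lemma zariski_closure_mat_commutator:
  assumes S: "S \<subseteq> carrier_mat m m" and T: "T \<subseteq> carrier_mat m m"
    and inv: "\<And>B. B \<in> S \<Longrightarrow> \<exists>B'\<in>carrier_mat m m. B * B' = 1\<^sub>m m"
    and comm: "\<And>x y x' y'. x \<in> S \<Longrightarrow> y \<in> S \<Longrightarrow> x' \<in> carrier_mat m m \<Longrightarrow> y' \<in> carrier_mat m m \<Longrightarrow>
      x * x' = 1\<^sub>m m \<Longrightarrow> y * y' = 1\<^sub>m m \<Longrightarrow> x * y * x' * y' \<in> T"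
    and x: "x \<in> zariski_closure_mat m S" "x' \<in> carrier_mat m m" "x * x' = 1\<^sub>m m"
    and y: "y \<in> zariski_closure_mat m S" "y' \<in> carrier_mat m m" "y * y' = 1\<^sub>m m"
  shows "x * y * x' * y' \<in> zariski_closure_mat m T"
proof -
  have xC: "x \<in> carrier_mat m m" and yC: "y \<in> carrier_mat m m"
    using x(1) y(1) by (auto dest: zariski_closure_mat_carrier)
  have half: "x * z * x' * z' \<in> zariski_closure_mat m T"
    if z: "z \<in> S" "z' \<in> carrier_mat m m" "z * z' = 1\<^sub>m m" for z z'
  proof (rule zariski_closure_mat_mult_right[OF z(2)])
    let ?T = "{M \<in> carrier_mat m m. M * z' \<in> T}"
    have zC: "z \<in> carrier_mat m m" using z(1) S by blast
    show "?T \<subseteq> carrier_mat m m" by blast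
    show "x * z * x' \<in> zariski_closure_mat m ?T"
    proof (rule zariski_closure_mat_conj[OF S zC _ x])
      fix B assume B: "B \<in> S"
      then obtain B' where "B' \<in> carrier_mat m m" "B * B' = 1\<^sub>m m" using inv by blast
      then show "\<exists>B'\<in>carrier_mat m m. B * B' = 1\<^sub>m m \<and> B * z * B' \<in> ?T"
        using comm[OF B z(1) _ z(2) _ z(3)] S B zC by (intro bexI[of _ B']) auto
    qed
  qed simp
  let ?T = "{M \<in> carrier_mat m m. x * M \<in> zariski_closure_mat m T}"
  have "y * x' * y' \<in> zariski_closure_mat m ?T"
  proof (rule zariski_closure_mat_conj[OF S x(2) _ y])
    fix B assume B: "B \<in> S"
    then obtain B' where B': "B' \<in> carrier_mat m m" "B * B' = 1\<^sub>m m" using inv by blast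
    have BC: "B \<in> carrier_mat m m" using B S by blast
    have "x * (B * x' * B') = x * B * x' * B'" 
      using assoc_mult_mat[OF xC mult_carrier_mat[OF BC x(2)] B'(1)] assoc_mult_mat[OF xC BC x(2)]
      by metis
    then have "x * (B * x' * B') \<in> zariski_closure_mat m T" using half[OF B B'] by simp
    then show "\<exists>B'\<in>carrier_mat m m. B * B' = 1\<^sub>m m \<and> B * x' * B' \<in> ?T"
      using B' BC x(2) by (intro bexI[of _ B']) auto
  qed
  then have "x * (y * x' * y') \<in> zariski_closure_mat m (zariski_closure_mat m T)"
    by (rule zariski_closure_mat_mult_left[OF xC, rotated 2]) auto
  moreover have "x * (y * x' * y') = x * y * x' * y'" 
    using assoc_mult_mat[OF xC mult_carrier_mat[OF yC x(2)] y(2)] assoc_mult_mat[OF xC yC x(2)]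
    by metis
  ultimately show ?thesis by (simp add: zariski_closure_mat_idem)
qed

lemma row_pert_inverse:
  assumes "i < m" "\<psi> i \<noteq> - 1"
  shows "row_pert m i \<psi> * row_pert m i (\<lambda>b. - \<psi> b / (1 + \<psi> i)) = 1\<^sub>m m"
proof -
  have "1 + \<psi> i \<noteq> 0" using assms(2) by (simp add: add_eq_0_iff)
  then have "- \<psi> b / (1 + \<psi> i) + \<psi> b + \<psi> i * (- \<psi> b / (1 + \<psi> i)) = 0" for b
    by (simp add: field_simps)
  then show ?thesis unfolding row_pert_mult_same[OF assms(1)] by (simp add: row_pert_zero)
qed

text \<open>Take for I + f_i \<psi> the diagonal matrix with 2 in place i and 1 elsewhere. As
  \<phi>(f_i) = 0, conjugation by it doubles \<phi>, and removing one copy of \<phi> leaves the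
  original transvection.\<close>

lemma transvection_commutator:
  assumes i: "i < m" and \<phi>: "\<phi> i = 0"
  shows "\<exists>\<psi> \<psi>'. row_pert m i \<psi> * row_pert m i \<psi>' = 1\<^sub>m m \<and>
    row_pert m i \<phi> * row_pert m i (\<lambda>b. - \<phi> b) = 1\<^sub>m m \<and>
    row_pert m i \<psi> * row_pert m i \<phi> * row_pert m i \<psi>' * row_pert m i (\<lambda>b. - \<phi> b) = row_pert m i \<phi>"
proof (intro exI conjI)
  let ?\<psi> = "\<lambda>b. if b = i then 1 else 0" and ?\<psi>' = "\<lambda>b. if b = i then - 1 / 2 else 0"
  show "row_pert m i ?\<psi> * row_pert m i ?\<psi>' = 1\<^sub>m m"
    unfolding row_pert_mult_same[OF i] row_pert_zero[symmetric, of m i] by (rule row_pert_cong) simp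
  show "row_pert m i \<phi> * row_pert m i (\<lambda>b. - \<phi> b) = 1\<^sub>m m"
    unfolding row_pert_mult_same[OF i] row_pert_zero[symmetric, of m i] by (rule row_pert_cong) (simp add: \<phi>)
  show "row_pert m i ?\<psi> * row_pert m i \<phi> * row_pert m i ?\<psi>' * row_pert m i (\<lambda>b. - \<phi> b) = row_pert m i \<phi>"
    unfolding row_pert_mult_same[OF i] by (rule row_pert_cong) (simp add: \<phi>)
qed

text \<open>The matrix need not be triangular, but it is a commutator of invertible matrices, so its
  determinant is 1.\<close>

lemma det_transvection:
  assumes i: "i < m" and \<phi>: "\<phi> i = 0"
  shows "det (row_pert m i \<phi>) = 1"
proof -
  have det: "det (A * B) = det A * det B" if "A \<in> carrier_mat m m" "B \<in> carrier_mat m m"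
    for A B :: "complex mat" using that by (rule det_mult)
  obtain \<psi> \<psi>' where *: "row_pert m i \<psi> * row_pert m i \<psi>' = 1\<^sub>m m"
    "row_pert m i \<phi> * row_pert m i (\<lambda>b. - \<phi> b) = 1\<^sub>m m"
    "row_pert m i \<psi> * row_pert m i \<phi> * row_pert m i \<psi>' * row_pert m i (\<lambda>b. - \<phi> b) = row_pert m i \<phi>"
    using transvection_commutator[of i m \<phi>, OF i \<phi>] by blast
  from *(1) have "det (row_pert m i \<psi>) * det (row_pert m i \<psi>') = 1"
    by (metis det det_one row_pert_carrier)
  moreover from *(2) have "det (row_pert m i \<phi>) * det (row_pert m i (\<lambda>b. - \<phi> b)) = 1"
    by (metis det det_one row_pert_carrier)
  moreover have "det (row_pert m i \<phi>) = det (row_pert m i \<psi>) * det (row_pert m i \<phi>) *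
      det (row_pert m i \<psi>') * det (row_pert m i (\<lambda>b. - \<phi> b))"
    by (subst *(3)[symmetric]) (simp add: det mult_carrier_mat[of _ m m _ m])
  ultimately show ?thesis by (simp add: mult.commute mult.left_commute)
qed

section \<open>Generation of SL by transvections\<close>

text \<open>Left multiplication by this matrix adds v a times row k to each row a, so it clears a
  whole column in one stroke.\<close>

definition col_pert :: "nat \<Rightarrow> nat \<Rightarrow> (nat \<Rightarrow> complex) \<Rightarrow> complex mat" where
  "col_pert m k v = mat m m (\<lambda>(a, b). (if a = b then 1 else 0) + (if b = k then v a else 0))"

lemma col_pert_carrier [simp]: "col_pert m k v \<in> carrier_mat m m"
  by (simp add: col_pert_def)

lemma index_col_pert_mult:
  assumes A: "A \<in> carrier_mat m m" and ab: "a < m" "b < m" and k: "k < m"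
  shows "(col_pert m k v * A) $$ (a, b) = A $$ (a, b) + v a * A $$ (k, b)"
proof -
  have "(col_pert m k v * A) $$ (a, b) =
      (\<Sum>x<m. (if x = a then A $$ (x, b) else 0) + (if x = k then v a * A $$ (x, b) else 0))"
    using index_mult_mat_sum[OF _ A ab, of "col_pert m k v"] ab
    by (auto intro!: sum.cong simp: algebra_simps col_pert_def)
  also have "\<dots> = A $$ (a, b) + v a * A $$ (k, b)"
    using ab k by (simp add: sum.distrib)
  finally show ?thesis .
qed

text \<open>Abstracts what Gaussian elimination needs; it will be applied to the intersection of the
  closure of the Burau image with SL.\<close>

locale transvection_monoid =
  fixes m :: nat and N :: "complex mat set"
  assumes N_SL: "N \<subseteq> SL_mat m"
    and N_mult: "\<And>A B. A \<in> N \<Longrightarrow> B \<in> N \<Longrightarrow> A * B \<in> N"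
    and N_one: "1\<^sub>m m \<in> N"
    and N_transvection: "\<And>i \<phi>. i < m \<Longrightarrow> \<phi> i = 0 \<Longrightarrow> row_pert m i \<phi> \<in> N"
begin

lemma N_absorb:
  assumes "U \<in> N" "U \<in> carrier_mat m m" "U' \<in> carrier_mat m m" "A \<in> carrier_mat m m"
    "U * U' = 1\<^sub>m m" "U' * A \<in> N"
  shows "A \<in> N"
proof -
  have "U * (U' * A) = A"
    using assoc_mult_mat[OF assms(2-4)] assms(4,5) by simp
  then show ?thesis using N_mult[OF assms(1,6)] by simp
qed

lemma col_pert_in_N:
  assumes k: "k < m" and v: "v k = 0"
  shows "col_pert m k v \<in> N"
proof -
  have "col_pert m k (\<lambda>a. if a \<in> J then v a else 0) \<in> N" if "finite J" "J \<subseteq> {..<m}" for J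
    using that
  proof (induction J rule: finite_induct)
    case empty
    have "col_pert m k (\<lambda>a. if a \<in> {} then v a else 0) = 1\<^sub>m m"
      by (rule eq_matI) (auto simp: col_pert_def)
    then show ?case using N_one by simp
  next
    case (insert j J)
    show ?case
    proof (cases "j = k")
      case True
      then have "(\<lambda>a. if a \<in> insert j J then v a else 0) = (\<lambda>a. if a \<in> J then v a else 0)"
        using v by auto
      then show ?thesis using insert by simp
    next
      case False
      have j: "j < m" using insert by simp
      let ?R = "row_pert m j (\<lambda>b. if b = k then v j else 0)"
      let ?C = "\<lambda>J. col_pert m k (\<lambda>a. if a \<in> J then v a else 0)"
      have "?R * ?C J = ?C (insert j J)"
      proof (rule eq_matI)
        fix a b assume "a < dim_row (?C (insert j J))" "b < dim_col (?C (insert j J))"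
        then have ab: "a < m" "b < m" by (simp_all add: col_pert_def)
        have "(\<Sum>x<m. (if x = k then v j else 0) * ?C J $$ (x, b))
            = (\<Sum>x<m. if x = k then v j * ?C J $$ (x, b) else 0)"
          by (rule sum.cong) auto
        also have "\<dots> = v j * ?C J $$ (k, b)" using k by simp
        finally show "(?R * ?C J) $$ (a, b) = ?C (insert j J) $$ (a, b)"
          unfolding index_row_pert_mult[OF col_pert_carrier ab]
          using ab k j v False insert.hyps by (auto simp: col_pert_def)
      qed (simp_all add: col_pert_def)
      moreover have "?R \<in> N" using N_transvection[OF j] False by auto
      moreover have "?C J \<in> N" using insert by simp
      ultimately show ?thesis using N_mult by metis
    qed
  qed
  from this[of "{..<m}"] have "col_pert m k (\<lambda>a. if a \<in> {..<m} then v a else 0) \<in> N" by simp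
  moreover have "col_pert m k (\<lambda>a. if a \<in> {..<m} then v a else 0) = col_pert m k v"
    by (rule eq_matI) (auto simp: col_pert_def)
  ultimately show ?thesis by simp
qed

lemma SL_mat_mult: "U \<in> SL_mat m \<Longrightarrow> B \<in> SL_mat m \<Longrightarrow> U * B \<in> SL_mat m"
  by (auto simp: SL_mat_def det_mult[of _ m])

text \<open>With pivot 1, subtracting multiples of row k clears column k. The earlier columns
  survive because row k is zero there. The hypothesis \<open>IH\<close> is the elimination already
  completed for matrices with one more unit column.\<close>

lemma SL_mat_pivot_one:
  assumes B: "B \<in> SL_mat m" and k: "k < m" and piv: "B $$ (k, k) = 1"
    and cols: "\<And>a b. a < m \<Longrightarrow> b < k \<Longrightarrow> B $$ (a, b) = (if a = b then 1 else 0)"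
    and IH: "\<And>B. B \<in> SL_mat m \<Longrightarrow>
      (\<And>a b. a < m \<Longrightarrow> b < Suc k \<Longrightarrow> B $$ (a, b) = (if a = b then 1 else 0)) \<Longrightarrow> B \<in> N"
  shows "B \<in> N"
proof -
  define v where "v a = (if a = k then 0 else B $$ (a, k))" for a
  let ?U = "col_pert m k v" and ?U' = "col_pert m k (\<lambda>a. - v a)"
  have U: "?U \<in> N" "?U' \<in> N" by (simp_all add: col_pert_in_N k v_def)
  have BC: "B \<in> carrier_mat m m" using B by (simp add: SL_mat_def)
  show ?thesis
  proof (rule N_absorb[OF U(1) _ _ BC])
    show "?U * ?U' = 1\<^sub>m m"
    proof (rule eq_matI)
      fix a b assume "a < dim_row (1\<^sub>m m)" "b < dim_col (1\<^sub>m m)"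
      then have ab: "a < m" "b < m" by simp_all
      show "(?U * ?U') $$ (a, b) = 1\<^sub>m m $$ (a, b)"
        unfolding index_col_pert_mult[OF col_pert_carrier ab k]
        using ab k by (auto simp: col_pert_def v_def)
    qed (simp_all add: col_pert_def)
    show "?U' * B \<in> N"
    proof (rule IH)
      show "?U' * B \<in> SL_mat m" using U(2) N_SL B by (intro SL_mat_mult) auto
      fix a b assume ab: "a < m" "b < Suc k"
      then have b: "b < m" using k by simp
      show "(?U' * B) $$ (a, b) = (if a = b then 1 else 0)"
        unfolding index_col_pert_mult[OF BC ab(1) b k]
        using ab cols[of a b] cols[of k b] k piv by (cases "b = k") (auto simp: v_def)
    qed
  qed simp_all
qed

lemma index_addrow:
  assumes "A \<in> carrier_mat m m" "a < m" "b < m" "r < m"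
  shows "(row_pert m i (\<lambda>x. if x = r then s else 0) * A) $$ (a, b) =
    A $$ (a, b) + (if a = i then s * A $$ (r, b) else 0)"
proof -
  have "(\<Sum>x<m. (if x = r then s else 0) * A $$ (x, b)) = (\<Sum>x<m. if x = r then s * A $$ (r, b) else 0)"
    by (rule sum.cong) auto
  then show ?thesis
    unfolding index_row_pert_mult[OF assms(1-3)] using assms(4) by simp
qed

lemma N_addrow:
  assumes A: "A \<in> carrier_mat m m" and ir: "i < m" "r < m" "r \<noteq> i"
    and RA: "row_pert m i (\<lambda>x. if x = r then s else 0) * A \<in> N"
  shows "A \<in> N"
proof (rule N_absorb[OF _ _ _ A _ RA])
  show "row_pert m i (\<lambda>x. if x = r then - s else 0) \<in> N"
    using ir by (intro N_transvection) auto
  show "row_pert m i (\<lambda>x. if x = r then - s else 0) * row_pert m i (\<lambda>x. if x = r then s else 0) = 1\<^sub>m m"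
    unfolding row_pert_mult_same[OF ir(1)] row_pert_zero[symmetric, of m i]
    using ir by (intro row_pert_cong) auto
qed simp_all

lemma addrow_SL_mat:
  assumes "A \<in> SL_mat m" "i < m" "r < m" "r \<noteq> i"
  shows "row_pert m i (\<lambda>x. if x = r then s else 0) * A \<in> SL_mat m"
proof -
  have "row_pert m i (\<lambda>x. if x = r then s else 0) \<in> N"
    using assms by (intro N_transvection) auto
  then show ?thesis using N_SL assms(1) by (intro SL_mat_mult) auto
qed

text \<open>A nonzero entry below the pivot allows the pivot to be adjusted to 1 by adding a
  multiple of its row, with no diagonal matrix involved. That row vanishes in the columns before k,
  so these stay intact.\<close>

lemma SL_mat_below_pivot:
  assumes A: "A \<in> SL_mat m" and k: "k < m" and r: "k < r" "r < m" "A $$ (r, k) \<noteq> 0"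
    and cols: "\<And>a b. a < m \<Longrightarrow> b < k \<Longrightarrow> A $$ (a, b) = (if a = b then 1 else 0)"
    and IH: "\<And>B. B \<in> SL_mat m \<Longrightarrow>
      (\<And>a b. a < m \<Longrightarrow> b < Suc k \<Longrightarrow> B $$ (a, b) = (if a = b then 1 else 0)) \<Longrightarrow> B \<in> N"
  shows "A \<in> N"
proof -
  have AC: "A \<in> carrier_mat m m" using A by (simp add: SL_mat_def)
  define s where "s = (1 - A $$ (k, k)) / A $$ (r, k)"
  have rk: "r \<noteq> k" using r by simp
  show ?thesis
  proof (rule N_addrow[OF AC k r(2) rk], rule SL_mat_pivot_one[OF _ k])
    let ?B = "row_pert m k (\<lambda>x. if x = r then s else 0) * A"
    show "?B \<in> SL_mat m" by (rule addrow_SL_mat[OF A k r(2) rk])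
    show "?B $$ (k, k) = 1"
      unfolding index_addrow[OF AC k k r(2)] using r(3) by (simp add: s_def)
    show "?B $$ (a, b) = (if a = b then 1 else 0)" if "a < m" "b < k" for a b
      unfolding index_addrow[OF AC that(1) less_trans[OF that(2) k] r(2)]
      using that cols[of a b] cols[of r b] r by auto
  qed (rule IH)
qed

text \<open>In the last column the determinant forces pivot 1. Otherwise a nonzero entry is needed
  below the pivot; if there is none, the pivot itself is nonzero by invertibility and can be copied
  one row down.\<close>

lemma SL_mat_step:
  assumes A: "A \<in> SL_mat m" and k: "k < m"
    and cols: "\<And>a b. a < m \<Longrightarrow> b < k \<Longrightarrow> A $$ (a, b) = (if a = b then 1 else 0)"
    and IH: "\<And>B. B \<in> SL_mat m \<Longrightarrow>
      (\<And>a b. a < m \<Longrightarrow> b < Suc k \<Longrightarrow> B $$ (a, b) = (if a = b then 1 else 0)) \<Longrightarrow> B \<in> N"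
  shows "A \<in> N"
proof -
  have AC: "A \<in> carrier_mat m m" and detA: "det A = 1" using A by (simp_all add: SL_mat_def)
  consider "Suc k = m" | r where "k < r" "r < m" "A $$ (r, k) \<noteq> 0"
    | "Suc k < m" "\<And>r. k < r \<Longrightarrow> r < m \<Longrightarrow> A $$ (r, k) = 0"
    using k by (metis Suc_lessI)
  then show ?thesis
  proof cases
    case 1
    have "upper_triangular A"
      using AC cols 1 by (intro upper_triangularI) auto
    then have "det A = (\<Prod>i = 0..<m. A $$ (i, i))"
      using det_upper_triangular[OF _ AC] AC by (simp add: prod_list_diag_prod)
    also have "{0..<m} = insert k {0..<k}" using 1 by auto
    also have "(\<Prod>i\<in>insert k {0..<k}. A $$ (i, i)) = A $$ (k, k) * (\<Prod>i\<in>{0..<k}. A $$ (i, i))"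
      by simp
    also have "(\<Prod>i\<in>{0..<k}. A $$ (i, i)) = 1" using cols k by (intro prod.neutral) auto
    finally have "A $$ (k, k) = 1" using detA by simp
    then show ?thesis by (rule SL_mat_pivot_one[OF A k _ cols IH])
  next
    case (2 r)
    then show ?thesis using SL_mat_below_pivot[OF A k _ _ _ cols IH] by blast
  next
    case 3
    have pivot: "A $$ (k, k) \<noteq> 0"
    proof
      assume 0: "A $$ (k, k) = 0"
      \<comment> \<open>With a zero pivot and zeros below it, column k is a combination of the unit
        columns before it; \<open>v\<close> records this dependence as a kernel vector.\<close>
      define v where "v = vec m (\<lambda>b. if b = k then 1 else if b < k then - A $$ (b, k) else 0)"
      have "A *\<^sub>v v = 0\<^sub>v m"
      proof (rule eq_vecI)
        fix a assume "a < dim_vec (0\<^sub>v m)"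
        then have a: "a < m" by simp
        have "(A *\<^sub>v v) $ a = (\<Sum>b<m. A $$ (a, b) * v $ b)"
          using a AC by (simp add: scalar_prod_def lessThan_atLeast0 v_def)
        also have "\<dots> = (\<Sum>b<m. (if b = k then A $$ (a, k) else 0) +
            (if b = a then (if a < k then - A $$ (a, k) else 0) else 0))"
          using cols[OF a] by (intro sum.cong refl) (auto simp: v_def)
        also have "\<dots> = A $$ (a, k) + (if a < k then - A $$ (a, k) else 0)"
          using a k by (simp add: sum.distrib)
        also have "\<dots> = 0" using 0 3(2)[OF _ a] by (cases a k rule: linorder_cases) auto
        finally show "(A *\<^sub>v v) $ a = 0\<^sub>v m $ a" using a by simp
      qed (use AC in simp)
      moreover have "v \<in> carrier_vec m" by (simp add: v_def)
      moreover have "v \<noteq> 0\<^sub>v m"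
      proof
        assume "v = 0\<^sub>v m"
        then have "v $ k = 0" using k by simp
        then show False using k by (simp add: v_def)
      qed
      ultimately have "det A = 0" using det_0_iff_vec_prod_zero[OF AC] by blast
      then show False using detA by simp
    qed
    let ?B = "row_pert m (Suc k) (\<lambda>x. if x = k then 1 else 0) * A"
    show ?thesis
    proof (rule N_addrow[OF AC 3(1) k], simp)
      show "?B \<in> N"
      proof (rule SL_mat_below_pivot[OF _ k _ 3(1)])
        show "?B \<in> SL_mat m" by (rule addrow_SL_mat[OF A 3(1) k]) simp
        show "?B $$ (Suc k, k) \<noteq> 0"
          unfolding index_addrow[OF AC 3(1) k k] using pivot 3 by simp
        show "?B $$ (a, b) = (if a = b then 1 else 0)" if "a < m" "b < k" for a b
          unfolding index_addrow[OF AC that(1) less_trans[OF that(2) k] k]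
          using that cols[of a b] cols[of k b] k by auto
      qed (simp, rule IH)
    qed
  qed
qed

lemma SL_mat_subset_N: "SL_mat m \<subseteq> N"
proof
  fix A assume "A \<in> SL_mat m"
  have "A \<in> N" if "A \<in> SL_mat m" "k \<le> m"
    "\<And>a b. a < m \<Longrightarrow> b < k \<Longrightarrow> A $$ (a, b) = (if a = b then 1 else 0)" for A k
    using that(2,1,3)
  \<comment> \<open>k counts the leading unit columns; the induction descends from k = m, where only
    the identity is left.\<close>
  proof (induction k arbitrary: A rule: inc_induct)
    case base
    then have "A = 1\<^sub>m m" by (intro eq_matI) (auto simp: SL_mat_def)
    then show ?case using N_one by simp
  next
    case (step k)
    show ?case by (rule SL_mat_step[OF step.prems(1) step.hyps(2) step.prems(2) step.IH])
  qed
  from this[of A 0] show "A \<in> N" using \<open>A \<in> SL_mat m\<close> by simp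
qed

end

subsection \<open>The reduced Burau matrices\<close>

text \<open>The form phi_i: its values on f_i, f_(i-1), f_(i+1) are -1-q, 1, q. The test
  \<open>Suc b = i\<close> avoids truncated subtraction at i = 0.\<close>

definition burau_row :: "complex \<Rightarrow> nat \<Rightarrow> nat \<Rightarrow> complex" where
  "burau_row q i b = (if b = i then - 1 - q else if Suc b = i then 1 else if b = Suc i then q else 0)"

lemma F_basis_carrier: "F_basis q1 q2 n \<in> carrier_mat n (n - 1)"
  by (simp add: F_basis_def)

text \<open>The top n - 1 rows of the basis matrix are lower bidiagonal with q2 on the diagonal, so
  M is recovered row by row. This is the uniqueness behind the description in
  \<open>rho_gen\<close>.\<close>

lemma F_basis_cancel:
  assumes q2: "q2 \<noteq> 0" and M: "M \<in> carrier_mat (n - 1) (n - 1)" "M' \<in> carrier_mat (n - 1) (n - 1)"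
    and eq: "F_basis q1 q2 n * M = F_basis q1 q2 n * M'"
  shows "M = M'"
proof -
  have idx: "(F_basis q1 q2 n * N) $$ (r, j) = q2 * N $$ (r, j) + (if r = 0 then 0 else q1 * N $$ (r - 1, j))"
    if N: "N \<in> carrier_mat (n - 1) (n - 1)" and rj: "r < n - 1" "j < n - 1" for N r j
  proof -
    have r: "r < n" using rj by simp
    have "(F_basis q1 q2 n * N) $$ (r, j) = (\<Sum>x<n - 1. (if x = r then q2 * N $$ (r, j) else 0)
        + (if x = r - 1 then (if r = 0 then 0 else q1 * N $$ (r - 1, j)) else 0))"
      unfolding index_mult_mat_sum[OF F_basis_carrier N r rj(2)]
      using r by (intro sum.cong refl) (auto simp: F_basis_def)
    also have "\<dots> = q2 * N $$ (r, j) + (if r = 0 then 0 else q1 * N $$ (r - 1, j))"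
      using rj by (simp add: sum.distrib)
    finally show ?thesis .
  qed
  have "M $$ (r, j) = M' $$ (r, j)" if j: "j < n - 1" and r: "r < n - 1" for r j
    using r
  proof (induction r)
    case 0
    show ?case using idx[OF M(1) 0 j] idx[OF M(2) 0 j] eq q2 by simp
  next
    case (Suc r)
    then show ?case using idx[OF M(1) Suc.prems j] idx[OF M(2) Suc.prems j] eq q2 by simp
  qed
  then show ?thesis using M by (intro eq_matI) auto
qed

text \<open>On E the operator sigma_i - q1 sends e_i to f_i, e_(i+1) to -f_i and the other basis
  vectors to 0. Hence it maps x to (x_i - x_(i+1)) f_i; evaluating this form on the f_j gives q1
  phi_i.\<close>

lemma rho_gen_eq:
  assumes q: "q1 \<noteq> 0" "q2 \<noteq> 0" and i: "i < n - 1"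
  shows "rho_gen q1 q2 n i = q1 \<cdot>\<^sub>m row_pert (n - 1) i (burau_row (- q2 / q1) i)"
    (is "_ = ?M")
  unfolding rho_gen_def
proof (rule the_equality)
  have MC: "?M \<in> carrier_mat (n - 1) (n - 1)" by simp
  have "burau_E q1 q2 n i * F_basis q1 q2 n = F_basis q1 q2 n * ?M"
  proof (rule eq_matI)
    fix r j assume "r < dim_row (F_basis q1 q2 n * ?M)" "j < dim_col (F_basis q1 q2 n * ?M)"
    then have rj: "r < n" "j < n - 1" by (simp_all add: F_basis_def)
    let ?E = "\<lambda>r c. burau_E q1 q2 n i $$ (r, c)" and ?F = "\<lambda>r c. F_basis q1 q2 n $$ (r, c)"
    have "(burau_E q1 q2 n i * F_basis q1 q2 n) $$ (r, j) =
      (\<Sum>x<n. (if x = j then ?E r j * q2 else 0) + (if x = Suc j then ?E r (Suc j) * q1 else 0))"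
      using index_mult_mat_sum[of "burau_E q1 q2 n i" n n, OF _ F_basis_carrier rj] rj
      by (auto intro!: sum.cong simp: burau_E_def F_basis_def)
    also have "\<dots> = ?E r j * q2 + ?E r (Suc j) * q1"
      using rj by (simp add: sum.distrib) linarith
    also have "\<dots> = q1 * ?F r j + ?F r i * (q1 * burau_row (- q2 / q1) i j)"
    proof -
      have c: "q1 * burau_row (- q2 / q1) i j = 
          (if j = i then q2 - q1 else if Suc j = i then q1 else if j = Suc i then - q2 else 0)"
        using q by (simp add: burau_row_def field_simps)
      consider "j = i" | "Suc j = i" | "j = Suc i" | "j \<noteq> i" "Suc j \<noteq> i" "j \<noteq> Suc i" by blast
      then show ?thesis
        unfolding c using rj i by cases (auto simp: burau_E_def F_basis_def algebra_simps)
    qed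
    also have "\<dots> = (\<Sum>x<n - 1. (if x = j then q1 * ?F r j else 0)
        + (if x = i then ?F r i * (q1 * burau_row (- q2 / q1) i j) else 0))"
      using rj i by (simp add: sum.distrib)
    also have "\<dots> = (F_basis q1 q2 n * ?M) $$ (r, j)"
      unfolding index_mult_mat_sum[OF F_basis_carrier MC rj]
      using rj by (intro sum.cong refl) (auto simp: algebra_simps)
    finally show "(burau_E q1 q2 n i * F_basis q1 q2 n) $$ (r, j) = (F_basis q1 q2 n * ?M) $$ (r, j)" .
  qed (simp_all add: burau_E_def F_basis_def)
  then show "?M \<in> carrier_mat (n - 1) (n - 1) \<and>
      burau_E q1 q2 n i * F_basis q1 q2 n = F_basis q1 q2 n * ?M"
    using MC by blast
  then show "M = ?M" if "M \<in> carrier_mat (n - 1) (n - 1) \<and>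
      burau_E q1 q2 n i * F_basis q1 q2 n = F_basis q1 q2 n * M" for M
    using that F_basis_cancel[OF q(2), of M n ?M q1] by auto
qed

text \<open>At q = 1 this would be minus the Cartan matrix of type A_m. A kernel vector satisfies a
  three-term recurrence with solution q^i w_i = w_0 (1 + q + ... + q^i). The boundary value w_m = 0
  then gives w_0 (1 + ... + q^m) = 0, and the sum is nonzero since q^(m+1) \<noteq> 1.\<close>

lemma det_burau_row:
  assumes q: "q \<noteq> 0" and root: "\<And>d. 0 < d \<Longrightarrow> q ^ d \<noteq> 1"
  shows "det (mat m m (\<lambda>(i, j). burau_row q i j)) \<noteq> 0"
proof -
  define A where "A = mat m m (\<lambda>(i, j). burau_row q i j)"
  have A: "A \<in> carrier_mat m m" by (simp add: A_def)
  have "v = 0\<^sub>v m" if v: "v \<in> carrier_vec m" "A *\<^sub>v v = 0\<^sub>v m" for v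
  proof -
    \<comment> \<open>Extension by zero past the end, so that the last row of the system obeys the
      same recurrence and supplies the boundary value at index m.\<close>
    define w where "w i = (if i < m then v $ i else 0)" for i
    have rec: "q * w (Suc i) = (1 + q) * w i - (if i = 0 then 0 else w (i - 1))" if i: "i < m" for i
    proof -
      have "0 = (A *\<^sub>v v) $ i" using v i by simp
      also have "\<dots> = (\<Sum>b<m. burau_row q i b * v $ b)"
        using i v(1) by (simp add: A_def scalar_prod_def lessThan_atLeast0)
      also have "\<dots> = (\<Sum>b<m. (if b = i then (- 1 - q) * w i else 0)
          + (if b = i - 1 then (if i = 0 then 0 else w (i - 1)) else 0)
          + (if b = Suc i then q * w (Suc i) else 0))"
        using i by (intro sum.cong refl) (auto simp: burau_row_def w_def)
      also have "\<dots> = (- 1 - q) * w i + (if i = 0 then 0 else w (i - 1)) + q * w (Suc i)"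
        using i by (auto simp: sum.distrib w_def)
      finally show ?thesis by (auto simp: algebra_simps)
    qed
    have sol: "q ^ i * w i = w 0 * (\<Sum>j\<le>i. q ^ j)" if "i \<le> m" for i
      using that
    proof (induction i rule: less_induct)
      case (less i)
      consider "i = 0" | "i = 1" | k where "i = Suc (Suc k)"
        by (metis One_nat_def old.nat.exhaust)
      then show ?case
      proof cases
        case 2
        then show ?thesis using rec[of 0] less.prems by (simp add: algebra_simps)
      next
        case (3 k)
        have IH: "q ^ k * w k = w 0 * (\<Sum>j\<le>k. q ^ j)"
          "q ^ Suc k * w (Suc k) = w 0 * (\<Sum>j\<le>Suc k. q ^ j)"
          using less.IH[of k] less.IH[of "Suc k"] less.prems 3 by simp_all
        have "q ^ i * w i = q ^ Suc k * (q * w (Suc (Suc k)))" by (simp add: 3)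
        also have "q * w (Suc (Suc k)) = (1 + q) * w (Suc k) - w k"
          using rec[of "Suc k"] less.prems 3 by simp
        also have "q ^ Suc k * \<dots> = (1 + q) * (q ^ Suc k * w (Suc k)) - q * (q ^ k * w k)"
          by (simp add: algebra_simps)
        also have "\<dots> = w 0 * (\<Sum>j\<le>i. q ^ j)"
          unfolding IH by (simp add: 3 algebra_simps)
        finally show ?thesis .
      qed simp
    qed
    have "(q - 1) * (\<Sum>j\<le>m. q ^ j) = q ^ Suc m - 1"
      using power_diff_1_eq[of q "Suc m"] by (simp add: lessThan_Suc_atMost del: power_Suc)
    then have "(\<Sum>j\<le>m. q ^ j) \<noteq> 0" using root[of "Suc m"] by auto
    moreover have "w 0 * (\<Sum>j\<le>m. q ^ j) = 0" using sol[of m] by (simp add: w_def)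
    ultimately have "w 0 = 0" by simp
    then have "w i = 0" if "i \<le> m" for i using sol[OF that] q by simp
    then have "v $ i = 0" if "i < m" for i using that by (metis less_imp_le w_def)
    then show ?thesis using v(1) by (intro eq_vecI) auto
  qed
  then show ?thesis using det_0_iff_vec_prod_zero[OF A] unfolding A_def by blast
qed

subsection \<open>The closure of the Burau image\<close>

lemma one_smult_mat: "(1 :: complex) \<cdot>\<^sub>m A = A"
  by (rule eq_matI) auto

lemma smult_smult_mat: "(c :: complex) \<cdot>\<^sub>m (d \<cdot>\<^sub>m A) = (c * d) \<cdot>\<^sub>m A"
  by (rule eq_matI) auto

lemma smult_mult_smult_mat:
  fixes A B :: "complex mat"
  assumes "A \<in> carrier_mat m m" "B \<in> carrier_mat m m"
  shows "(c \<cdot>\<^sub>m A) * (d \<cdot>\<^sub>m B) = (c * d) \<cdot>\<^sub>m (A * B)"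
  using mult_smult_assoc_mat[OF assms(1) smult_carrier_mat[OF assms(2)], of c d]
    mult_smult_distrib[OF assms, of d] by (simp add: smult_smult_mat)

locale burau =
  fixes n m :: nat and q1 q2 q :: complex
  assumes m: "m = n - 1" "m > 0"
    and q: "q = - q2 / q1" "q1 \<noteq> 0" "q2 \<noteq> 0" "q \<noteq> 0"
    and not_root: "\<And>d::nat. d > 0 \<Longrightarrow> q ^ d \<noteq> 1"
begin

abbreviation "\<Gamma> \<equiv> burau_image q1 q2 n"
abbreviation "\<phi> \<equiv> burau_row q"
abbreviation "\<rho> \<equiv> rho_gen q1 q2 n"

lemmas image_induct = burau_image.induct[of _ q1 q2 n, folded m(1), consumes 1, case_names one gen inv]
lemmas image_one = burau_image.one[of n q1 q2, folded m(1)]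
lemmas image_gen = burau_image.gen[of _ q1 q2 n, folded m(1)]
lemmas image_inv = burau_image.inv[of _ q1 q2 n, folded m(1)]

lemma rho: "i < m \<Longrightarrow> \<rho> i = q1 \<cdot>\<^sub>m row_pert m i (\<phi> i)"
  using rho_gen_eq[OF q(2,3), of i n] by (simp add: m(1) q(1))

lemma rho_carrier: "i < m \<Longrightarrow> \<rho> i \<in> carrier_mat m m"
  by (simp add: rho)

lemma phi_diag: "\<phi> i i = - 1 - q"
  by (simp add: burau_row_def)

lemma image_carrier: "g \<in> \<Gamma> \<Longrightarrow> g \<in> carrier_mat m m"
  by (induction rule: image_induct) (auto intro: mult_carrier_mat rho_carrier)

lemma image_mult:
  assumes "g \<in> \<Gamma>" "h \<in> \<Gamma>"
  shows "g * h \<in> \<Gamma>"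
  using assms(2)
proof (induction rule: image_induct)
  case one
  then show ?case using assms(1) image_carrier[OF assms(1)] by simp
next
  case (gen M i)
  have "g * (M * \<rho> i) = g * M * \<rho> i"
    by (rule assoc_mult_mat[symmetric]) (use gen assms(1) image_carrier rho_carrier in auto)
  then show ?case using image_gen[OF gen.IH gen.hyps(2)] by simp
next
  case (inv M i G)
  have "g * (M * G) = g * M * G"
    by (rule assoc_mult_mat[symmetric]) (use inv assms(1) image_carrier in auto)
  then show ?case using image_inv[OF inv.IH inv.hyps(2-4)] by simp
qed

lemma rho_inverse:
  assumes i: "i < m"
  obtains G where "G \<in> carrier_mat m m" "G * \<rho> i = 1\<^sub>m m" "\<rho> i * G = 1\<^sub>m m"
proof -
  let ?R = "row_pert m i (\<lambda>b. - \<phi> i b / (1 + \<phi> i i))"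
  let ?G = "(1 / q1) \<cdot>\<^sub>m ?R"
  have "\<phi> i i \<noteq> - 1" using phi_diag q by simp
  then have "\<rho> i * ?G = 1\<^sub>m m"
    unfolding rho[OF i] smult_mult_smult_mat[OF row_pert_carrier row_pert_carrier]
    using row_pert_inverse[OF i, of "\<phi> i"] q(2) by (simp add: one_smult_mat)
  moreover have "?G * \<rho> i = 1\<^sub>m m"
    by (rule mat_mult_left_right_inverse[OF rho_carrier[OF i] _ calculation]) simp
  ultimately show ?thesis using that[of ?G] by simp
qed

lemma image_inverse:
  assumes "g \<in> \<Gamma>"
  shows "\<exists>g'\<in>\<Gamma>. g * g' = 1\<^sub>m m"
  using assms
proof (induction rule: image_induct)
  case one
  then show ?case using image_one by force
next
  case (gen M i)
  obtain M' where M': "M' \<in> \<Gamma>" "M * M' = 1\<^sub>m m" using gen.IH by blast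
  obtain G where G: "G \<in> carrier_mat m m" "G * \<rho> i = 1\<^sub>m m" "\<rho> i * G = 1\<^sub>m m"
    using rho_inverse[OF gen.hyps(2)] .
  have "1\<^sub>m m * G \<in> \<Gamma>" by (rule image_inv[OF image_one gen.hyps(2) G(1,2)])
  then have "G * M' \<in> \<Gamma>" using image_mult M'(1) G(1) by simp
  moreover have "M * \<rho> i * (G * M') = 1\<^sub>m m"
  proof -
    note C = image_carrier[OF gen.hyps(1)] rho_carrier[OF gen.hyps(2)] G(1) image_carrier[OF M'(1)]
    have "M * \<rho> i * (G * M') = M * (\<rho> i * (G * M'))"
      by (rule assoc_mult_mat[OF C(1,2) mult_carrier_mat[OF C(3,4)]])
    also have "\<rho> i * (G * M') = M'"
      using assoc_mult_mat[OF C(2-4)] G(3) C(4) by simp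
    finally show ?thesis using M'(2) by simp
  qed
  ultimately show ?case by blast
next
  case (inv M i G)
  obtain M' where M': "M' \<in> \<Gamma>" "M * M' = 1\<^sub>m m" using inv.IH by blast
  have "1\<^sub>m m * \<rho> i \<in> \<Gamma>" by (rule image_gen[OF image_one inv.hyps(2)])
  then have "\<rho> i * M' \<in> \<Gamma>" using image_mult M'(1) rho_carrier[OF inv.hyps(2)] by simp
  moreover have "M * G * (\<rho> i * M') = 1\<^sub>m m"
  proof -
    note C = image_carrier[OF inv.hyps(1)] inv.hyps(3) rho_carrier[OF inv.hyps(2)] image_carrier[OF M'(1)]
    have "M * G * (\<rho> i * M') = M * (G * (\<rho> i * M'))"
      by (rule assoc_mult_mat[OF C(1,2) mult_carrier_mat[OF C(3,4)]])
    also have "G * (\<rho> i * M') = M'"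
      using assoc_mult_mat[OF C(2-4)] inv.hyps(4) C(4) by simp
    finally show ?thesis using M'(2) by simp
  qed
  ultimately show ?case by blast
qed

definition scaled_image :: "complex mat set" where
  "scaled_image = {c \<cdot>\<^sub>m g | c g. c \<noteq> 0 \<and> g \<in> \<Gamma>}"

lemma scaled_imageI: "c \<noteq> 0 \<Longrightarrow> g \<in> \<Gamma> \<Longrightarrow> c \<cdot>\<^sub>m g \<in> scaled_image"
  by (auto simp: scaled_image_def)

sublocale scaled: mat_monoid m scaled_image
proof
  show "scaled_image \<subseteq> carrier_mat m m"
    using image_carrier by (auto simp: scaled_image_def)
  show "1\<^sub>m m \<in> scaled_image"
    using scaled_imageI[of 1, OF _ image_one] by (simp add: one_smult_mat)
  show "A * B \<in> scaled_image" if AB: "A \<in> scaled_image" "B \<in> scaled_image" for A B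
  proof -
    obtain c g d h where "A = c \<cdot>\<^sub>m g" "B = d \<cdot>\<^sub>m h" "c \<noteq> 0" "d \<noteq> 0" "g \<in> \<Gamma>" "h \<in> \<Gamma>"
      using AB by (auto simp: scaled_image_def)
    then show ?thesis
      using scaled_imageI[of "c * d" "g * h"] image_mult smult_mult_smult_mat[of g m h c d]
      by (simp add: image_carrier)
  qed
qed

lemma scaled_image_commutator:
  assumes xy: "x \<in> scaled_image" "y \<in> scaled_image"
    and C: "x' \<in> carrier_mat m m" "y' \<in> carrier_mat m m"
    and inv: "x * x' = 1\<^sub>m m" "y * y' = 1\<^sub>m m"
  shows "x * y * x' * y' \<in> \<Gamma>"
proof -
  \<comment> \<open>Right inverses of square matrices are unique, so the given z' must be the
    inverse scalar times a group element; that is why the scalars cancel below.\<close>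
  have *: "\<exists>c g g'. c \<noteq> 0 \<and> g \<in> \<Gamma> \<and> g' \<in> \<Gamma> \<and> z = c \<cdot>\<^sub>m g \<and> z' = (1 / c) \<cdot>\<^sub>m g'"
    if z: "z \<in> scaled_image" "z' \<in> carrier_mat m m" "z * z' = 1\<^sub>m m" for z z'
  proof -
    obtain c g where cg: "c \<noteq> 0" "g \<in> \<Gamma>" "z = c \<cdot>\<^sub>m g" using z(1) by (auto simp: scaled_image_def)
    obtain g' where g': "g' \<in> \<Gamma>" "g * g' = 1\<^sub>m m" using image_inverse[OF cg(2)] by blast
    note D = image_carrier[OF cg(2)] image_carrier[OF g'(1)]
    have zC: "z \<in> carrier_mat m m" using cg D by simp
    have "z * ((1 / c) \<cdot>\<^sub>m g') = 1\<^sub>m m" 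
      using cg g' smult_mult_smult_mat[OF D, of c "1 / c"] by (simp add: one_smult_mat)
    moreover have "z' * z = 1\<^sub>m m" by (rule mat_mult_left_right_inverse[OF zC z(2,3)])
    moreover have "z' * z * ((1 / c) \<cdot>\<^sub>m g') = z' * (z * ((1 / c) \<cdot>\<^sub>m g'))"
      by (rule assoc_mult_mat[OF z(2) zC smult_carrier_mat[OF D(2)]])
    ultimately have "z' = (1 / c) \<cdot>\<^sub>m g'" using z(2) D by simp
    then show ?thesis using cg g' by blast
  qed
  obtain c g g' where x: "c \<noteq> 0" "g \<in> \<Gamma>" "g' \<in> \<Gamma>" "x = c \<cdot>\<^sub>m g" "x' = (1 / c) \<cdot>\<^sub>m g'"
    using *[OF xy(1) C(1) inv(1)] by blast
  obtain d h h' where y: "d \<noteq> 0" "h \<in> \<Gamma>" "h' \<in> \<Gamma>" "y = d \<cdot>\<^sub>m h" "y' = (1 / d) \<cdot>\<^sub>m h'"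
    using *[OF xy(2) C(2) inv(2)] by blast
  note D = x(2,3)[THEN image_carrier] y(2,3)[THEN image_carrier]
  have "x * y = (c * d) \<cdot>\<^sub>m (g * h)" unfolding x y by (rule smult_mult_smult_mat[OF D(1,3)])
  then have "x * y * x' = d \<cdot>\<^sub>m (g * h * g')"
    unfolding x(5) using smult_mult_smult_mat[OF mult_carrier_mat[OF D(1,3)] D(2), of "c * d" "1 / c"] x(1)
    by simp
  then have "x * y * x' * y' = g * h * g' * h'"
    unfolding y(5)
    using smult_mult_smult_mat[OF mult_carrier_mat[OF mult_carrier_mat[OF D(1,3)] D(2)] D(4), of d "1 / d"] y(1)
    by (simp add: one_smult_mat)
  then show ?thesis using x y image_mult by simp
qed

lemma minus_q_power: 
  assumes "0 < d" shows "(- q) ^ d \<noteq> 1"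
proof
  assume "(- q) ^ d = 1"
  then have "((- q) ^ d) ^ 2 = 1" by simp
  moreover have "((- q) ^ d) ^ 2 = q ^ (d * 2)"
    unfolding power_mult[symmetric] by (rule power_minus_even) simp
  ultimately have "q ^ (d * 2) = 1" by simp
  moreover have "q ^ (d * 2) \<noteq> 1" using not_root[of "d * 2"] assms by simp
  ultimately show False by simp
qed

text \<open>Since phi_i(f_i) = -1-q, each further power of I + f_i phi_i replaces the coefficient t
  by 1 - q t. The resulting geometric sums are infinitely many points on the line I + t f_i phi_i,
  so the whole line lies in the closure.\<close>

lemma burau_row_dirs:
  assumes i: "i < m"
  shows "\<phi> i \<in> row_dirs m scaled.Z i"
proof -
  define t where "t k = (\<Sum>j<k. (- q) ^ j)" for k :: nat
  have mem: "row_pert m i (\<lambda>b. t k * \<phi> i b) \<in> scaled_image" for k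
  proof (induction k)
    case 0
    show ?case using scaled.S_one by (simp add: t_def row_pert_zero)
  next
    case (Suc k)
    have "1\<^sub>m m * \<rho> i \<in> \<Gamma>" by (rule image_gen[OF image_one i])
    then have "(1 / q1) \<cdot>\<^sub>m \<rho> i \<in> scaled_image"
      using q(2) rho_carrier[OF i] by (intro scaled_imageI) auto
    then have "row_pert m i (\<phi> i) \<in> scaled_image"
      using q(2) by (simp add: rho i smult_smult_mat one_smult_mat)
    from scaled.S_mult[OF this Suc]
    have "row_pert m i (\<lambda>b. t k * \<phi> i b + \<phi> i b + \<phi> i i * (t k * \<phi> i b)) \<in> scaled_image"
      unfolding row_pert_mult_same[OF i] .
    moreover have "t (Suc k) = 1 + (- q) * t k"
      unfolding t_def sum.lessThan_Suc_shift by (simp add: sum_distrib_left)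
    then have "t k * \<phi> i b + \<phi> i b + \<phi> i i * (t k * \<phi> i b) = t (Suc k) * \<phi> i b" for b
      by (simp only: phi_diag) (simp add: algebra_simps)
    ultimately show ?case by simp
  qed
  have "inj t"
  proof (rule linorder_injI)
    fix k l :: nat assume "k < l"
    show "t k \<noteq> t l"
    proof
      assume eq: "t k = t l"
      have geo: "(- q - 1) * t j = (- q) ^ j - 1" for j
        unfolding t_def by (rule power_diff_1_eq[symmetric])
      have "(- q) ^ k = (- q) ^ l" using geo[of k] geo[of l] eq by simp
      also have "\<dots> = (- q) ^ k * (- q) ^ (l - k)"
        using \<open>k < l\<close> by (simp flip: power_add)
      finally have "(- q) ^ (l - k) = 1" using q by simp
      then show False using minus_q_power[of "l - k"] \<open>k < l\<close> by simp
    qed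
  qed
  then have "infinite (range t)" using range_inj_infinite by blast
  moreover have "range t \<subseteq> {t. row_pert m i (\<lambda>b. t * \<phi> i b) \<in> scaled.Z}"
    using mem subset_zariski_closure_mat[OF scaled.S_carrier] by blast
  ultimately have "infinite {t. row_pert m i (\<lambda>b. t * \<phi> i b) \<in> scaled.Z}"
    using finite_subset by blast
  then have "row_pert m i (\<lambda>b. t * \<phi> i b) \<in> scaled.Z" for t
    by (rule zariski_closure_mat_curve[rotated 2]) auto
  then show ?thesis by (auto simp: row_dirs_def)
qed

lemma row_pert_in_scaled_closure: "i < m \<Longrightarrow> row_pert m i \<psi> \<in> scaled.Z"
proof (rule scaled.row_pert_in_closure[where \<phi> = \<phi>])
  \<comment> \<open>The value -1-q is nonzero because -q \<noteq> 1, the case d = 1.\<close>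
  show "\<phi> i i \<noteq> 0" for i using minus_q_power[of 1] by (auto simp: phi_diag algebra_simps)
  show "det (mat m m (\<lambda>(i, j). \<phi> i j)) \<noteq> 0"
    using det_burau_row q(4) not_root by blast
  show "\<phi> j \<in> row_dirs m scaled.Z j" if "j < m" for j
    using that by (rule burau_row_dirs)
qed (use q(4) in \<open>simp_all add: burau_row_def\<close>)

lemma transvection_in_closure:
  assumes i: "i < m" and \<psi>: "\<psi> i = 0"
  shows "row_pert m i \<psi> \<in> zariski_closure_mat m \<Gamma>"
proof -
  obtain \<chi> \<chi>' where *: "row_pert m i \<chi> * row_pert m i \<chi>' = 1\<^sub>m m"
    "row_pert m i \<psi> * row_pert m i (\<lambda>b. - \<psi> b) = 1\<^sub>m m"
    "row_pert m i \<chi> * row_pert m i \<psi> * row_pert m i \<chi>' * row_pert m i (\<lambda>b. - \<psi> b) = row_pert m i \<psi>"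
    using transvection_commutator[of i m \<psi>, OF i \<psi>] by blast
  have "row_pert m i \<chi> * row_pert m i \<psi> * row_pert m i \<chi>' * row_pert m i (\<lambda>b. - \<psi> b)
      \<in> zariski_closure_mat m \<Gamma>"
  proof (rule zariski_closure_mat_commutator[OF scaled.S_carrier _ _ scaled_image_commutator])
    fix B assume "B \<in> scaled_image"
    then obtain c g where cg: "c \<noteq> 0" "g \<in> \<Gamma>" "B = c \<cdot>\<^sub>m g" by (auto simp: scaled_image_def)
    obtain g' where "g' \<in> \<Gamma>" "g * g' = 1\<^sub>m m" using image_inverse[OF cg(2)] by blast
    then show "\<exists>B'\<in>carrier_mat m m. B * B' = 1\<^sub>m m"
      using cg image_carrier smult_mult_smult_mat[of g m g' c "1 / c"]
      by (intro bexI[of _ "(1 / c) \<cdot>\<^sub>m g'"]) (simp_all add: one_smult_mat)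
  qed (use * i row_pert_in_scaled_closure image_carrier in auto)
  then show ?thesis unfolding *(3) .
qed

lemma SL_mat_subset_closure: "SL_mat m \<subseteq> zariski_closure_mat m \<Gamma>"
proof -
  have \<Gamma>: "\<Gamma> \<subseteq> carrier_mat m m" using image_carrier by blast
  interpret transvection_monoid m "zariski_closure_mat m \<Gamma> \<inter> SL_mat m"
  proof
    show "1\<^sub>m m \<in> zariski_closure_mat m \<Gamma> \<inter> SL_mat m"
      using subset_zariski_closure_mat[OF \<Gamma>] image_one by (auto simp: SL_mat_def)
    show "A * B \<in> zariski_closure_mat m \<Gamma> \<inter> SL_mat m"
      if "A \<in> zariski_closure_mat m \<Gamma> \<inter> SL_mat m" "B \<in> zariski_closure_mat m \<Gamma> \<inter> SL_mat m" for A B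
      using that zariski_closure_mat_mult_closed[OF \<Gamma> image_mult]
      by (auto simp: SL_mat_def det_mult[of _ m])
    show "row_pert m i \<psi> \<in> zariski_closure_mat m \<Gamma> \<inter> SL_mat m" if "i < m" "\<psi> i = 0" for i \<psi>
      using that transvection_in_closure det_transvection by (simp add: SL_mat_def)
  qed simp
  show ?thesis using SL_mat_subset_N by blast
qed

end

section \<open>Commutants on tensor powers\<close>

lemma index_tensor_pow:
  "I < m ^ k \<Longrightarrow> J < m ^ k \<Longrightarrow> tensor_pow m k A $$ (I, J) = (\<Prod>j<k. A $$ (digit m I j, digit m J j))"
  by (simp add: tensor_pow_def)

lemma tensor_pow_carrier: "tensor_pow m k A \<in> carrier_mat (m ^ k) (m ^ k)"
  by (simp add: tensor_pow_def)

lemma tensor_pow_smult: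
  assumes "A \<in> carrier_mat m m" "m > 0"
  shows "tensor_pow m k (c \<cdot>\<^sub>m A) = c ^ k \<cdot>\<^sub>m tensor_pow m k A"
  by (rule eq_matI) (use assms in \<open>auto simp: tensor_pow_def digit_def prod.distrib\<close>)

lemma End_tensor_closure:
  assumes m: "m > 0" and T: "T \<in> End_tensor m k S" and A: "A \<in> zariski_closure_mat m S"
  shows "T * tensor_pow m k A = tensor_pow m k A * T"
proof (rule eq_matI)
  let ?P = "tensor_pow m k"
  have TC: "T \<in> carrier_mat (m ^ k) (m ^ k)" using T by (simp add: End_tensor_def)
  note PC = tensor_pow_carrier[of m k]
  fix I J assume "I < dim_row (?P A * T)" "J < dim_col (?P A * T)"
  then have IJ: "I < m ^ k" "J < m ^ k" using TC by (simp_all add: tensor_pow_def)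
  \<comment> \<open>One entry of the commutator of T with the tensor power, as a polynomial in the
    entries of the matrix; the difference is written with the factor - 1 because
    \<open>poly_fun\<close> is generated by sums and products.\<close>
  define p where "p = (\<lambda>A. (\<Sum>x<m ^ k. T $$ (I, x) * (\<Prod>j<k. A $$ (digit m x j, digit m J j)))
      + (- 1) * (\<Sum>x<m ^ k. (\<Prod>j<k. A $$ (digit m I j, digit m x j)) * T $$ (x, J)))"
  have p_eq: "p B = (T * ?P B) $$ (I, J) - (?P B * T) $$ (I, J)" for B
    unfolding index_mult_mat_sum[OF TC PC IJ] index_mult_mat_sum[OF PC TC IJ] p_def
    by (simp add: index_tensor_pow IJ)
  have "p \<in> poly_fun m"
    unfolding p_def using m
    by (intro poly_fun.add poly_fun.mult poly_fun_sum poly_fun_prod poly_fun.const poly_fun.entry)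
       (simp_all add: digit_def)
  moreover have "p B = 0" if "B \<in> S" for B
    using T that unfolding p_eq End_tensor_def by simp
  ultimately have "p A = 0" using A by (auto simp: zariski_closure_mat_def)
  then show "(T * ?P A) $$ (I, J) = (?P A * T) $$ (I, J)" unfolding p_eq by simp
qed (use T in \<open>auto simp: End_tensor_def tensor_pow_def\<close>)

text \<open>The scalar is an m-th root of the determinant, which exists because the complex numbers
  are algebraically closed.\<close>

lemma GL_mat_scale_SL_mat:
  assumes A: "A \<in> GL_mat m" and m: "m > 0"
  obtains c B where "B \<in> SL_mat m" "A = c \<cdot>\<^sub>m B"
proof -
  obtain c where c: "c ^ m = det A" using nth_root_exists[OF m] by blast
  have AC: "A \<in> carrier_mat m m" and "det A \<noteq> 0" using A by (simp_all add: GL_mat_def)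
  then have "c \<noteq> 0" using c m by (metis power_0_left less_irrefl)
  have "det ((1 / c) \<cdot>\<^sub>m A) = (1 / c) ^ m * c ^ m" using AC c by simp
  also have "\<dots> = 1" using \<open>c \<noteq> 0\<close> by (simp add: power_divide)
  finally have "(1 / c) \<cdot>\<^sub>m A \<in> SL_mat m" using AC by (simp add: SL_mat_def)
  moreover have "A = c \<cdot>\<^sub>m ((1 / c) \<cdot>\<^sub>m A)" using \<open>c \<noteq> 0\<close> by (intro eq_matI) auto
  ultimately show ?thesis using that by blast
qed

lemma End_tensor_eq_GL:
  assumes m: "m > 0" and S: "S \<subseteq> GL_mat m" and SL: "SL_mat m \<subseteq> zariski_closure_mat m S"
  shows "End_tensor m k S = End_tensor m k (GL_mat m)"
proof
  show "End_tensor m k (GL_mat m) \<subseteq> End_tensor m k S"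
    using S by (auto simp: End_tensor_def)
  show "End_tensor m k S \<subseteq> End_tensor m k (GL_mat m)"
  proof
    fix T assume T: "T \<in> End_tensor m k S"
    then have TC: "T \<in> carrier_mat (m ^ k) (m ^ k)" by (simp add: End_tensor_def)
    have "T * tensor_pow m k A = tensor_pow m k A * T" if A: "A \<in> GL_mat m" for A
    proof -
      obtain c B where B: "B \<in> SL_mat m" "A = c \<cdot>\<^sub>m B" using GL_mat_scale_SL_mat[OF A m] .
      then have "tensor_pow m k A = c ^ k \<cdot>\<^sub>m tensor_pow m k B"
        using tensor_pow_smult[of B m k c] m by (simp add: SL_mat_def)
      moreover have "T * tensor_pow m k B = tensor_pow m k B * T"
        using End_tensor_closure[OF m T] B(1) SL by blast
      ultimately show ?thesis
        using mult_smult_distrib[OF TC tensor_pow_carrier] mult_smult_assoc_mat[OF tensor_pow_carrier TC]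
        by simp
    qed
    then show "T \<in> End_tensor m k (GL_mat m)" using TC by (simp add: End_tensor_def)
  qed
qed

theorem theorem5p2:
  fixes n :: nat and q1 q2 :: complex
  assumes "n \<ge> 2"
    and "q1 * q2 \<noteq> 0"
    and "\<forall>d::nat. d > 0 \<longrightarrow> (- q2 / q1) ^ d \<noteq> 1"
  shows "SL_mat (n - 1) \<subseteq> zariski_closure_GL (n - 1) (burau_image q1 q2 n)
    \<and> (\<forall>k::nat. k \<ge> 1 \<longrightarrow>
         End_tensor (n - 1) k (burau_image q1 q2 n) = End_tensor (n - 1) k (GL_mat (n - 1)))"
proof (intro conjI allI impI)
  define m where "m = n - 1"
  interpret burau n m q1 q2 "- q2 / q1"
    by unfold_locales (use assms in \<open>auto simp: m_def\<close>)
  \<comment> \<open>Both closures are cut out by the same polynomials, so they agree on invertible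
    matrices.\<close>
  show "SL_mat (n - 1) \<subseteq> zariski_closure_GL (n - 1) \<Gamma>"
    using SL_mat_subset_closure unfolding m_def
    by (auto simp: zariski_closure_GL_def zariski_closure_mat_def SL_mat_def GL_mat_def)
  fix k :: nat
  have "\<Gamma> \<subseteq> GL_mat m"
  proof
    fix g assume g: "g \<in> \<Gamma>"
    then obtain g' where g': "g' \<in> \<Gamma>" "g * g' = 1\<^sub>m m" using image_inverse by blast
    then have "det g * det g' = 1"
      using det_mult[OF image_carrier[OF g] image_carrier[OF g'(1)]] by simp
    then show "g \<in> GL_mat m" using image_carrier[OF g] by (auto simp: GL_mat_def)
  qed
  then show "End_tensor (n - 1) k \<Gamma> = End_tensor (n - 1) k (GL_mat (n - 1))"
    using End_tensor_eq_GL[OF m(2) _ SL_mat_subset_closure] unfolding m_def by blast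
qed

end
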